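(* In a six-dimensional Lorentzian vector space with metric $g_{\mu\nu}$ of signature $(-,+,+,+,+,+)$, let $v^\mu$ be a unit timelike vector, $v^\mu v_\mu=-1$, let $F_{\mu\nu\rho}$ be a three-form, $E_{\mu\nu}=F_{\mu\nu\rho}v^\rho$, $B_{\mu\nu}=F^*_{\mu\nu\rho}v^\rho$, and let $\mathcal H(s,p)$ be a smooth function of the invariants $s,p$ of $B$ satisfying $$\mathcal H_s^2+\frac{2s}p\mathcal H_s\mathcal H_p+\mathcal H_p^2=1 .$$ Let $$T_{\mu\nu}=-g_{\mu\nu}\left(\mathcal H-\frac12H_{\rho\lambda}B^{\rho\lambda}\right)+\frac12v_\mu v_\nu H_{\rho\lambda}B^{\rho\lambda}-H_\mu{}^\rho B_{\nu\rho}-2v_{(\mu}p_{\nu)}$$ be the PST energy-momentum tensor. If the non-linear self-duality condition $E_{\mu\nu}=H_{\mu\nu}(B)$ holds (with $p\neq0$), then $$T_{\mu\nu}=g_{\mu\nu}\left(s\mathcal H_s+p\mathcal H_p-\mathcal H\right)+\frac14F_{\rho\lambda(\mu}F^{*}_{\nu)}{}^{\rho\lambda}.$$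
   Context: The dual of a three-form is $F^{*\,\mu\nu\rho}=\frac1{3!}\boldsymbol\varepsilon^{\mu\nu\rho\lambda\sigma\kappa}F_{\lambda\sigma\kappa}$, with $\boldsymbol\varepsilon$ the Levi-Civita tensor normalized in an oriented orthonormal frame by $\boldsymbol\varepsilon^{012345}=-1$. The invariants are $s=\frac14B_{\mu\nu}B^{\mu\nu}$, $p^\mu=-\frac18\boldsymbol\varepsilon^{\mu\nu\rho\lambda\sigma\kappa}B_{\rho\lambda}B_{\sigma\kappa}v_\nu$, $p=\sqrt{p_\mu p^\mu}$. The tensor $H_{\mu\nu}=2\,\partial\mathcal H/\partial B^{\mu\nu}$ is $$H_{\mu\nu}=\left(\mathcal H_s+2sp^{-1}\mathcal H_p\right)B_{\mu\nu}+p^{-1}\mathcal H_p(B^3)_{\mu\nu},\qquad (B^3)_{\mu\nu}=B_{\mu\rho}B^{\rho\tau}B_{\tau\nu}.$$ Symmetrization has weight one: $X_{(\mu\nu)}=\frac12(X_{\mu\nu}+X_{\nu\mu})$. *)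

theory Defs
  imports "HOL-Analysis.Analysis"
begin

text \<open>
  Tensors on a six-dimensional space are given by their components with respect to an arbitrary
  (not necessarily orthonormal) basis; the index type is \<open>6\<close>, with elements \<open>0, ..., 5\<close>.
  The metric is its matrix \<open>g\<close> of components in that basis.
\<close>

definition minkowski :: "6 \<Rightarrow> 6 \<Rightarrow> real" where
  "minkowski a b = (if a = b then (if a = 0 then -1 else 1) else 0)"

text \<open>
  \<open>e a $ \<mu>\<close> is the \<open>\<mu>\<close>-th component of the \<open>a\<close>-th frame vector.  By Sylvester's law, a
  symmetric \<open>g\<close> admits such a frame iff it has signature \<open>(-,+,+,+,+,+)\<close>.
\<close>

definition orthonormal_frame :: "real^6^6 \<Rightarrow> (6 \<Rightarrow> real^6) \<Rightarrow> bool" where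
  "orthonormal_frame g e \<longleftrightarrow>
     (\<forall>a b. (\<Sum>\<mu>\<in>UNIV. \<Sum>\<nu>\<in>UNIV. g $ \<mu> $ \<nu> * e a $ \<mu> * e b $ \<nu>) = minkowski a b)"

definition lower :: "real^6^6 \<Rightarrow> real^6 \<Rightarrow> real^6" where
  "lower g u = (\<chi> \<mu>. \<Sum>\<nu>\<in>UNIV. g $ \<mu> $ \<nu> * u $ \<nu>)"

definition lower2 :: "real^6^6 \<Rightarrow> real^6^6 \<Rightarrow> real^6^6" where
  "lower2 g X = (\<chi> \<mu> \<nu>. \<Sum>\<alpha>\<in>UNIV. \<Sum>\<beta>\<in>UNIV. g $ \<mu> $ \<alpha> * g $ \<nu> $ \<beta> * X $ \<alpha> $ \<beta>)"

definition raise2 :: "real^6^6 \<Rightarrow> real^6^6 \<Rightarrow> real^6^6" where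
  "raise2 g X = lower2 (matrix_inv g) X"

definition lower3 :: "real^6^6 \<Rightarrow> real^6^6^6 \<Rightarrow> real^6^6^6" where
  "lower3 g X = (\<chi> \<mu> \<nu> \<rho>. \<Sum>\<alpha>\<in>UNIV. \<Sum>\<beta>\<in>UNIV. \<Sum>\<gamma>\<in>UNIV.
      g $ \<mu> $ \<alpha> * g $ \<nu> $ \<beta> * g $ \<rho> $ \<gamma> * X $ \<alpha> $ \<beta> $ \<gamma>)"

text \<open>\<open>X\<^sub>\<mu>\<^sub>\<nu> Y\<^sup>\<mu>\<^sup>\<nu>\<close> for covariant \<open>X\<close>, \<open>Y\<close>.\<close>

definition contract2 :: "real^6^6 \<Rightarrow> real^6^6 \<Rightarrow> real^6^6 \<Rightarrow> real" where
  "contract2 g X Y = (\<Sum>\<mu>\<in>UNIV. \<Sum>\<nu>\<in>UNIV. X $ \<mu> $ \<nu> * raise2 g Y $ \<mu> $ \<nu>)"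

definition symmetrize :: "real^6^6 \<Rightarrow> real^6^6" where
  "symmetrize X = (\<chi> \<mu> \<nu>. (X $ \<mu> $ \<nu> + X $ \<nu> $ \<mu>) / 2)"

definition three_form :: "real^6^6^6 \<Rightarrow> bool" where
  "three_form F \<longleftrightarrow>
     (\<forall>\<mu> \<nu> \<rho>. F $ \<mu> $ \<nu> $ \<rho> = - F $ \<nu> $ \<mu> $ \<rho> \<and> F $ \<mu> $ \<nu> $ \<rho> = - F $ \<mu> $ \<rho> $ \<nu>)"

text \<open>
  Contravariant components of the Levi-Civita tensor for the orientation of the frame \<open>e\<close>.  In the
  frame itself its components are \<open>- sign \<pi>\<close> at the index tuple \<open>(\<pi> 0, ..., \<pi> 5)\<close>, and zero at
  tuples that are not permutations.
\<close>

definition levi_civita ::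
    "(6 \<Rightarrow> real^6) \<Rightarrow> 6 \<Rightarrow> 6 \<Rightarrow> 6 \<Rightarrow> 6 \<Rightarrow> 6 \<Rightarrow> 6 \<Rightarrow> real" where
  "levi_civita e \<mu> \<nu> \<rho> \<alpha> \<beta> \<gamma> =
     (\<Sum>\<pi> | \<pi> permutes (UNIV :: 6 set). - of_int (sign \<pi>) *
        (e (\<pi> 0) $ \<mu> * e (\<pi> 1) $ \<nu> * e (\<pi> 2) $ \<rho> * e (\<pi> 3) $ \<alpha> * e (\<pi> 4) $ \<beta> * e (\<pi> 5) $ \<gamma>))"

text \<open>Contravariant components of the dual of a three-form with covariant components \<open>F\<close>.\<close>

definition dual3_up :: "(6 \<Rightarrow> real^6) \<Rightarrow> real^6^6^6 \<Rightarrow> real^6^6^6" where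
  "dual3_up e F = (\<chi> \<mu> \<nu> \<rho>. 1 / fact 3 *
     (\<Sum>\<alpha>\<in>UNIV. \<Sum>\<beta>\<in>UNIV. \<Sum>\<gamma>\<in>UNIV. levi_civita e \<mu> \<nu> \<rho> \<alpha> \<beta> \<gamma> * F $ \<alpha> $ \<beta> $ \<gamma>))"

definition dual3 :: "real^6^6 \<Rightarrow> (6 \<Rightarrow> real^6) \<Rightarrow> real^6^6^6 \<Rightarrow> real^6^6^6" where
  "dual3 g e F = lower3 g (dual3_up e F)"

definition contract_last :: "real^6^6^6 \<Rightarrow> real^6 \<Rightarrow> real^6^6" where
  "contract_last F v = (\<chi> \<mu> \<nu>. \<Sum>\<rho>\<in>UNIV. F $ \<mu> $ \<nu> $ \<rho> * v $ \<rho>)"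

definition inv_s :: "real^6^6 \<Rightarrow> real^6^6 \<Rightarrow> real" where
  "inv_s g B = 1 / 4 * contract2 g B B"

definition p_up :: "real^6^6 \<Rightarrow> (6 \<Rightarrow> real^6) \<Rightarrow> real^6 \<Rightarrow> real^6^6 \<Rightarrow> real^6" where
  "p_up g e v B = (\<chi> \<mu>. - 1 / 8 *
     (\<Sum>\<nu>\<in>UNIV. \<Sum>\<rho>\<in>UNIV. \<Sum>\<alpha>\<in>UNIV. \<Sum>\<beta>\<in>UNIV. \<Sum>\<gamma>\<in>UNIV.
        levi_civita e \<mu> \<nu> \<rho> \<alpha> \<beta> \<gamma> * B $ \<rho> $ \<alpha> * B $ \<beta> $ \<gamma> * lower g v $ \<nu>))"

definition p_down :: "real^6^6 \<Rightarrow> (6 \<Rightarrow> real^6) \<Rightarrow> real^6 \<Rightarrow> real^6^6 \<Rightarrow> real^6" where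
  "p_down g e v B = lower g (p_up g e v B)"

definition inv_p :: "real^6^6 \<Rightarrow> (6 \<Rightarrow> real^6) \<Rightarrow> real^6 \<Rightarrow> real^6^6 \<Rightarrow> real" where
  "inv_p g e v B = sqrt (\<Sum>\<mu>\<in>UNIV. p_down g e v B $ \<mu> * p_up g e v B $ \<mu>)"

text \<open>
  \<open>H\<^sub>\<mu>\<^sub>\<nu> = 2 \<partial>\<H>/\<partial>B\<^sup>\<mu>\<^sup>\<nu>\<close>, with the usual convention for derivatives with respect to an
  antisymmetric tensor: \<open>\<partial>B\<^sup>\<alpha>\<^sup>\<beta>/\<partial>B\<^sup>\<mu>\<^sup>\<nu> = (\<delta>\<^sup>\<alpha>\<^sub>\<mu> \<delta>\<^sup>\<beta>\<^sub>\<nu> - \<delta>\<^sup>\<alpha>\<^sub>\<nu> \<delta>\<^sup>\<beta>\<^sub>\<mu>) / 2\<close>, equivalently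
  \<open>d\<H> = 1/2 H\<^sub>\<mu>\<^sub>\<nu> dB\<^sup>\<mu>\<^sup>\<nu>\<close>.  The bivector \<open>\<partial>B/\<partial>B\<^sup>\<mu>\<^sup>\<nu>\<close> is lowered because \<open>B\<close> is
  represented by its covariant components.
\<close>

definition unit_bivector :: "6 \<Rightarrow> 6 \<Rightarrow> real^6^6" where
  "unit_bivector \<mu> \<nu> = (\<chi> \<alpha> \<beta>.
     (of_bool (\<alpha> = \<mu> \<and> \<beta> = \<nu>) - of_bool (\<alpha> = \<nu> \<and> \<beta> = \<mu>)) / 2)"

definition H_tensor ::
    "(real \<Rightarrow> real \<Rightarrow> real) \<Rightarrow> real^6^6 \<Rightarrow> (6 \<Rightarrow> real^6) \<Rightarrow> real^6 \<Rightarrow> real^6^6 \<Rightarrow> real^6^6" where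
  "H_tensor \<H> g e v B = (\<chi> \<mu> \<nu>. 2 * deriv (\<lambda>t.
     let B' = B + t *\<^sub>R lower2 g (unit_bivector \<mu> \<nu>) in \<H> (inv_s g B') (inv_p g e v B')) 0)"

text \<open>
  In the third term, \<open>H\<^sub>\<mu>\<^sup>\<rho> B\<^sub>\<nu>\<^sub>\<rho> = H\<^sub>\<mu>\<^sub>\<sigma> g\<^sup>\<sigma>\<^sup>\<rho> B\<^sub>\<nu>\<^sub>\<rho>\<close>.
\<close>

definition pst_tensor ::
    "(real \<Rightarrow> real \<Rightarrow> real) \<Rightarrow> real^6^6 \<Rightarrow> (6 \<Rightarrow> real^6) \<Rightarrow> real^6 \<Rightarrow> real^6^6 \<Rightarrow> real^6^6" where
  "pst_tensor \<H> g e v B =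
     (let H = H_tensor \<H> g e v B; HB = contract2 g H B in
      \<chi> \<mu> \<nu>. - g $ \<mu> $ \<nu> * (\<H> (inv_s g B) (inv_p g e v B) - 1 / 2 * HB)
        + 1 / 2 * lower g v $ \<mu> * lower g v $ \<nu> * HB
        - (\<Sum>\<sigma>\<in>UNIV. \<Sum>\<rho>\<in>UNIV. H $ \<mu> $ \<sigma> * matrix_inv g $ \<sigma> $ \<rho> * B $ \<nu> $ \<rho>)
        - 2 * symmetrize (\<chi> \<alpha> \<beta>. lower g v $ \<alpha> * p_down g e v B $ \<beta>) $ \<mu> $ \<nu>)"

text \<open>
  \<open>F\<^sub>\<rho>\<^sub>\<tau>\<^sub>\<mu> F\<^sup>*\<^sub>\<nu>\<^sup>\<rho>\<^sup>\<tau>\<close>, not yet symmetrized; only the first index of the dual is lowered.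
\<close>

definition FF_dual :: "real^6^6 \<Rightarrow> (6 \<Rightarrow> real^6) \<Rightarrow> real^6^6^6 \<Rightarrow> real^6^6" where
  "FF_dual g e F = (\<chi> \<mu> \<nu>. \<Sum>\<rho>\<in>UNIV. \<Sum>\<tau>\<in>UNIV.
     F $ \<rho> $ \<tau> $ \<mu> * (\<Sum>\<alpha>\<in>UNIV. g $ \<nu> $ \<alpha> * dual3_up e F $ \<alpha> $ \<rho> $ \<tau>))"

text \<open>Smoothness on an open set: all iterated directional derivatives exist and are continuous.\<close>

primrec Ck_on :: "nat \<Rightarrow> 'a::real_normed_vector set \<Rightarrow> ('a \<Rightarrow> real) \<Rightarrow> bool" where
  "Ck_on 0 D f \<longleftrightarrow> continuous_on D f"
| "Ck_on (Suc k) D f \<longleftrightarrow>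
     f differentiable_on D \<and> (\<forall>w. Ck_on k D (\<lambda>x. frechet_derivative f (at x) w))"

definition smooth_on :: "'a::real_normed_vector set \<Rightarrow> ('a \<Rightarrow> real) \<Rightarrow> bool" where
  "smooth_on D f \<longleftrightarrow> (\<forall>k. Ck_on k D f)"

definition partial_s :: "(real \<Rightarrow> real \<Rightarrow> real) \<Rightarrow> real \<Rightarrow> real \<Rightarrow> real" where
  "partial_s \<H> s p = deriv (\<lambda>x. \<H> x p) s"

definition partial_p :: "(real \<Rightarrow> real \<Rightarrow> real) \<Rightarrow> real \<Rightarrow> real \<Rightarrow> real" where
  "partial_p \<H> s p = deriv (\<lambda>y. \<H> s y) p"

end

(*
  The Levi-Civita tensor depends on the frame only through the determinant of the frame matrix, so
  a reflection replaces the frame by one of the same orientation whose zeroth vector is v.  In such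
  a frame B is a 5x5 antisymmetric matrix X, the spatial components of F are those of X, the mixed
  ones are E, and p is the vector P of 4x4 sub-Pfaffians of X.  Differentiating H gives
  E = H_s X + (H_p / p) N with N cubic in X, where X P = 0 yields P(N) = p^2 P and the polarised
  Pfaffian satisfies P(X, N) = 2 s P.  Hence P(E) = (H_s^2 + (2 s / p) H_s H_p + H_p^2) P = P by the
  differential equation; this is the time-space part of the identity.  The time-time part is the
  homogeneity relation E.X = 4 (s H_s + p H_p), and the space-space part is the contraction of two
  Levi-Civita symbols together with the symmetry of E X.
*)
theory Submission
  imports Defs
begin

section \<open>Frames adapted to a unit timelike vector\<close>

text \<open>In the time-space entries the symmetrized product of F and its dual sees P(E) + P(X),
  while the PST tensor sees 2 P(X); the differential equation enters to make these agree. The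
  expression 2 s B + B^3 is never formed from matrix powers. The tensor H is a derivative, and
  differentiating p^2, a sum of squared sub-Pfaffians, delivers N directly as the five-dimensional
  spatial dual of the wedge product of P and X. In this form P can be kept as a separate unknown, so
  that the identity P(N) = p^2 P, of degree six in the ten entries of X, follows from the five
  relations X P = 0 instead of a full expansion. The condition p > 0, which is what p nonzero means
  for a square root, serves to differentiate that root and to divide by p.\<close>

lemma UNIV_6: "(UNIV :: 6 set) = {0, 1, 2, 3, 4, 5}"
  by (rule sym, rule card_subset_eq) simp_all

lemma sum_6: "(\<Sum>i\<in>(UNIV :: 6 set). f i) = f 0 + f 1 + f 2 + f 3 + f 4 + (f 5 :: 'a :: comm_monoid_add)"
  unfolding UNIV_6 by (simp add: add.assoc)

lemma prod_6: "(\<Prod>i\<in>(UNIV :: 6 set). f i) = f 0 * f 1 * f 2 * f 3 * f 4 * (f 5 :: 'a :: comm_monoid_mult)"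
  unfolding UNIV_6 by (simp add: mult.assoc)

lemma sum_swap_2_1:
  "(\<Sum>i\<in>A. \<Sum>j\<in>B. \<Sum>k\<in>C. f i j k) = (\<Sum>k\<in>C. \<Sum>i\<in>A. \<Sum>j\<in>B. f i j k)"
  for f :: "_ \<Rightarrow> _ \<Rightarrow> _ \<Rightarrow> 'a :: comm_monoid_add"
proof -
  have "(\<Sum>i\<in>A. \<Sum>j\<in>B. \<Sum>k\<in>C. f i j k) = (\<Sum>i\<in>A. \<Sum>k\<in>C. \<Sum>j\<in>B. f i j k)"
    by (intro sum.cong refl sum.swap)
  also have "\<dots> = (\<Sum>k\<in>C. \<Sum>i\<in>A. \<Sum>j\<in>B. f i j k)"
    by (rule sum.swap)
  finally show ?thesis .
qed

lemma sum_swap_2_2: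
  "(\<Sum>i\<in>A. \<Sum>j\<in>B. \<Sum>k\<in>C. \<Sum>l\<in>D. f i j k l) = (\<Sum>k\<in>C. \<Sum>l\<in>D. \<Sum>i\<in>A. \<Sum>j\<in>B. f i j k l)"
  for f :: "_ \<Rightarrow> _ \<Rightarrow> _ \<Rightarrow> _ \<Rightarrow> 'a :: comm_monoid_add"
proof -
  have "(\<Sum>i\<in>A. \<Sum>j\<in>B. \<Sum>k\<in>C. \<Sum>l\<in>D. f i j k l) = (\<Sum>k\<in>C. \<Sum>i\<in>A. \<Sum>j\<in>B. \<Sum>l\<in>D. f i j k l)"
    by (rule sum_swap_2_1)
  also have "\<dots> = (\<Sum>k\<in>C. \<Sum>l\<in>D. \<Sum>i\<in>A. \<Sum>j\<in>B. f i j k l)"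
    by (intro sum.cong refl sum_swap_2_1)
  finally show ?thesis .
qed

text \<open>The sum over permutations is the Leibniz expansion of the determinant with entries
  \<open>e a $ m j\<close>. That matrix is the frame matrix times a matrix selecting the columns
  \<open>m j\<close>, so multiplicativity splits off the only factor that depends on the
  frame.\<close>

lemma levi_civita_det:
  "levi_civita e \<mu> \<nu> \<rho> \<alpha> \<beta> \<gamma> = - det (\<chi> a. e a) *
     det (\<chi> \<kappa> j. of_bool (\<kappa> = (if j = 0 then \<mu> else if j = 1 then \<nu> else if j = 2 then \<rho>
        else if j = 3 then \<alpha> else if j = 4 then \<beta> else \<gamma>)) :: real^6^6)"
proof -
  define m where "m j = (if j = 0 then \<mu> else if j = 1 then \<nu> else if j = 2 then \<rho>
        else if j = 3 then \<alpha> else if j = 4 then \<beta> else \<gamma>)" for j :: 6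
  have mat: "transpose ((\<chi> a. e a) ** (\<chi> \<kappa> j. of_bool (\<kappa> = m j))) = (\<chi> j a. e a $ m j)"
    by (simp add: vec_eq_iff matrix_matrix_mult_def transpose_def)
  have "det (\<chi> a. e a) * det (\<chi> \<kappa> j. of_bool (\<kappa> = m j) :: real^6^6) = det (\<chi> j a. e a $ m j)"
    unfolding mat[symmetric] det_transpose det_mul ..
  also have "\<dots> = - levi_civita e \<mu> \<nu> \<rho> \<alpha> \<beta> \<gamma>"
    unfolding det_def levi_civita_def prod_6 by (simp add: m_def sum_negf)
  finally show ?thesis
    by (simp add: m_def)
qed

section \<open>The inner product, orthonormal frames and reflections\<close>

definition ip :: "real^6^6 \<Rightarrow> real^6 \<Rightarrow> real^6 \<Rightarrow> real" where
  "ip g u w = (\<Sum>\<mu>\<in>UNIV. \<Sum>\<nu>\<in>UNIV. g $ \<mu> $ \<nu> * u $ \<mu> * w $ \<nu>)"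

lemma ip_linear:
  "ip g (u + u') w = ip g u w + ip g u' w" "ip g u (w + w') = ip g u w + ip g u w'"
  "ip g (u - u') w = ip g u w - ip g u' w" "ip g u (w - w') = ip g u w - ip g u w'"
  "ip g (- u) w = - ip g u w" "ip g u (- w) = - ip g u w"
  "ip g (c *\<^sub>R u) w = c * ip g u w" "ip g u (c *\<^sub>R w) = c * ip g u w"
  unfolding ip_def
  by (simp_all add: algebra_simps sum.distrib sum_subtractf sum_negf sum_distrib_left)

lemma transpose_eq_self_iff: "transpose g = g \<longleftrightarrow> (\<forall>i j. g $ i $ j = g $ j $ i)"
  by (auto simp: vec_eq_iff transpose_def)

lemma ip_commute:
  assumes "transpose g = g"
  shows "ip g u w = ip g w u"
proof -
  have "ip g u w = (\<Sum>\<nu>\<in>UNIV. \<Sum>\<mu>\<in>UNIV. g $ \<mu> $ \<nu> * u $ \<mu> * w $ \<nu>)"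
    unfolding ip_def by (rule sum.swap)
  also have "\<dots> = ip g w u"
    unfolding ip_def
  proof (intro sum.cong refl)
    fix a b
    have "g $ b $ a = g $ a $ b"
      using assms unfolding transpose_eq_self_iff by blast
    then show "g $ b $ a * u $ b * w $ a = g $ a $ b * w $ a * u $ b"
      by simp
  qed
  finally show ?thesis .
qed

lemma ip_lower: "ip g u w = (\<Sum>\<mu>\<in>UNIV. u $ \<mu> * lower g w $ \<mu>)"
  by (simp add: ip_def lower_def sum_distrib_left mult_ac)

lemma orthonormal_frame_ip: "orthonormal_frame g e \<longleftrightarrow> (\<forall>a b. ip g (e a) (e b) = minkowski a b)"
  by (simp add: orthonormal_frame_def ip_def)

lemma gram_matrix:
  assumes "orthonormal_frame g e"
  shows "(\<chi> a. e a) ** g ** transpose (\<chi> a. e a) = (\<chi> a b. minkowski a b)"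
proof -
  have "((\<chi> a. e a) ** g ** transpose (\<chi> a. e a)) $ a $ b = minkowski a b" for a b
  proof -
    have "((\<chi> a. e a) ** g ** transpose (\<chi> a. e a)) $ a $ b
       = (\<Sum>\<nu>\<in>UNIV. \<Sum>\<mu>\<in>UNIV. g $ \<mu> $ \<nu> * e a $ \<mu> * e b $ \<nu>)"
      by (simp add: matrix_matrix_mult_def transpose_def sum_distrib_left sum_distrib_right mult_ac)
    also have "\<dots> = minkowski a b"
      using assms by (subst sum.swap) (simp add: orthonormal_frame_def)
    finally show ?thesis .
  qed
  then show ?thesis by (simp add: vec_eq_iff)
qed

lemma det_minkowski: "det (\<chi> a b. minkowski a b) = -1"
proof -
  have "det (\<chi> a b. minkowski a b) = (\<Prod>i\<in>UNIV. (\<chi> a b. minkowski a b) $ i $ i)"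
    by (rule det_diagonal) (simp add: minkowski_def)
  then show ?thesis by (simp add: minkowski_def prod_6)
qed

text \<open>Determinants of both sides of the Gram relation. Consequently \<open>det g\<close> is
  nonzero and fixes the determinant of an orthonormal frame up to its sign.\<close>

lemma det_frame_sq:
  assumes "orthonormal_frame g e"
  shows "det g * (det (\<chi> a. e a))\<^sup>2 = -1"
proof -
  have "det ((\<chi> a. e a) ** g ** transpose (\<chi> a. e a)) = -1"
    using gram_matrix[OF assms] det_minkowski by simp
  then show ?thesis by (simp add: det_mul det_transpose power2_eq_square mult_ac)
qed

text \<open>The vectors v and \<plusminus> e_0 have the same norm, so the reflection along their
  difference exchanges them, provided that the difference is not null. A final change of sign of one
  spatial vector restores the orientation.\<close>

lemma exists_adapted_frame:
  assumes sym: "transpose g = g" and frame: "orthonormal_frame g e"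
    and v: "ip g v v = -1"
  obtains e' where "orthonormal_frame g e'" "e' 0 = v" "levi_civita e' = levi_civita e"
proof -
  have on: "ip g (e a) (e b) = minkowski a b" for a b
    using frame by (simp add: orthonormal_frame_ip)
  \<comment> \<open>The sign keeps \<open>w\<close> from being null. For \<open>r = 1\<close> its
    norm vanishes exactly when \<open>ip g v (e 0) = -1\<close>, and in that case
    \<open>r = -1\<close> gives the norm -4.\<close>
  define r :: real where "r = (if ip g v (e 0) = -1 then -1 else 1)"
  have r2: "r * r = 1" by (simp add: r_def)
  define w where "w = v - r *\<^sub>R e 0"
  have ve: "ip g (e 0) v = ip g v (e 0)" by (rule ip_commute[OF sym])
  have e00: "ip g (e 0) (e 0) = -1" by (simp add: on minkowski_def)
  have ww: "ip g w w = - 2 - 2 * r * ip g v (e 0)"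
    by (simp add: w_def ip_linear v e00 ve algebra_simps r2)
  have ww0: "ip g w w \<noteq> 0" by (auto simp: ww r_def)
  define R where "R u = u - (2 * ip g u w / ip g w w) *\<^sub>R w" for u
  have R: "ip g (R x) (R y) = ip g x y" for x y
  proof -
    have "ip g w y = ip g y w" by (rule ip_commute[OF sym])
    then have "ip g (R x) (R y) = ip g x y - 2 * (2 * ip g x w / ip g w w) * ip g y w
      + (2 * ip g x w / ip g w w) * (2 * ip g y w / ip g w w) * ip g w w"
      unfolding R_def ip_linear by (simp add: algebra_simps)
    also have "\<dots> = ip g x y" using ww0 by simp
    finally show ?thesis .
  qed
  have "ip g (e 0) w = ip g v (e 0) + r"
    by (simp add: w_def ip_linear ve e00)
  then have ew: "2 * r * ip g (e 0) w = - ip g w w"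
    by (simp add: ww algebra_simps r2)
  have "r *\<^sub>R R (e 0) = r *\<^sub>R e 0 - ((2 * r * ip g (e 0) w) / ip g w w) *\<^sub>R w"
    by (simp add: R_def algebra_simps)
  also have "\<dots> = r *\<^sub>R e 0 + w" unfolding ew using ww0 by simp
  also have "\<dots> = v" by (simp add: w_def)
  finally have Rv: "r *\<^sub>R R (e 0) = v" .
  define f where "f c a = (if a = 0 then v else if a = 1 then c *\<^sub>R R (e a) else R (e a))"
    for c :: real and a :: 6
  have f: "orthonormal_frame g (f c)" if "c * c = 1" for c
    unfolding orthonormal_frame_ip f_def Rv[symmetric]
    by (auto simp: ip_linear R on r2 that minkowski_def simp flip: mult.assoc)
  \<comment> \<open>Both frames belong to the same metric, so their determinants have equal
    squares.\<close>
  have "det g * (det (\<chi> a. f 1 a))\<^sup>2 = -1" "det g * (det (\<chi> a. e a))\<^sup>2 = -1"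
    using det_frame_sq f frame by simp_all
  then have "(det (\<chi> a. f 1 a))\<^sup>2 = (det (\<chi> a. e a))\<^sup>2"
    by (metis mult_cancel_left mult_zero_left neg_equal_0_iff_equal zero_neq_one)
  then have alt: "det (\<chi> a. f 1 a) = det (\<chi> a. e a) \<or> det (\<chi> a. f 1 a) = - det (\<chi> a. e a)"
    by (simp add: power2_eq_iff)
  have "det (\<chi> a. f (-1) a) = det (\<chi> a. if a = 1 then (-1) *s R (e a) else f 1 a)"
    by (rule arg_cong[where f = det]) (simp add: vec_eq_iff f_def)
  also have "\<dots> = - det (\<chi> a. if a = 1 then R (e a) else f 1 a)"
    by (subst det_row_mul) simp
  also have "(\<chi> a. if a = 1 then R (e a) else f 1 a) = (\<chi> a. f 1 a)"
    by (simp add: vec_eq_iff f_def)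
  finally have "det (\<chi> a. f (-1) a) = - det (\<chi> a. f 1 a)" .
  with alt obtain c where c: "c * c = 1" "det (\<chi> a. f c a) = det (\<chi> a. e a)"
    by (metis minus_equation_iff mult_1 mult_minus1 minus_minus)
  have "levi_civita (f c) = levi_civita e"
    by (intro ext) (simp add: levi_civita_det c)
  moreover have "f c 0 = v" by (simp add: f_def)
  ultimately show ?thesis using that f c by blast
qed

text \<open>Substitute \<sigma> \<circ> \<tau> for \<pi>: agreement with \<sigma> on
  \<open>K\<close> means that \<tau> fixes \<open>K\<close> pointwise, hence permutes the
  complement. Sums over all 720 permutations of the indices shrink to 6 or 24 terms.\<close>

lemma sum_permutations_fixing:
  fixes f :: "('a::finite \<Rightarrow> 'a) \<Rightarrow> real"
  assumes "\<sigma> permutes UNIV"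
  shows "(\<Sum>\<pi> | \<pi> permutes UNIV. of_int (sign \<pi>) * (if \<forall>k\<in>K. \<pi> k = \<sigma> k then f \<pi> else 0))
    = of_int (sign \<sigma>) * (\<Sum>\<tau> | \<tau> permutes (- K). of_int (sign \<tau>) * f (\<sigma> \<circ> \<tau>))"
proof -
  have inj: "inj \<sigma>" using assms by (rule permutes_inj)
  have sg: "sign (\<sigma> \<circ> \<tau>) = sign \<sigma> * sign \<tau>" if "\<tau> permutes UNIV" for \<tau>
    using assms that by (intro sign_compose) (auto simp: permutation_permutes)
  have "(\<Sum>\<pi> | \<pi> permutes UNIV. of_int (sign \<pi>) * (if \<forall>k\<in>K. \<pi> k = \<sigma> k then f \<pi> else 0))
    = (\<Sum>\<tau> | \<tau> permutes UNIV. of_int (sign (\<sigma> \<circ> \<tau>)) * (if \<forall>k\<in>K. \<tau> k = k then f (\<sigma> \<circ> \<tau>) else 0))"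
    by (subst setum_permutations_compose_left[OF assms]) (simp add: inj_eq[OF inj])
  also have "\<dots> = (\<Sum>\<tau> | \<tau> permutes (- K). of_int (sign (\<sigma> \<circ> \<tau>)) * f (\<sigma> \<circ> \<tau>))"
    by (rule sum.mono_neutral_cong_right)
       (auto simp: finite_permutations permutes_not_in permutes_subset intro: permutes_subset permutes_superset)
  also have "\<dots> = of_int (sign \<sigma>) * (\<Sum>\<tau> | \<tau> permutes (- K). of_int (sign \<tau>) * f (\<sigma> \<circ> \<tau>))"
    unfolding sum_distrib_left
    by (rule sum.cong) (auto simp: sg permutes_subset mult.assoc)
  finally show ?thesis .
qed

section \<open>Sums over permutations of the frame indices\<close>

definition antisym2 :: "('a \<Rightarrow> 'a \<Rightarrow> real) \<Rightarrow> bool" where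
  "antisym2 X \<longleftrightarrow> (\<forall>a b. X a b = - X b a)"

definition antisym3 :: "('a \<Rightarrow> 'a \<Rightarrow> 'a \<Rightarrow> real) \<Rightarrow> bool" where
  "antisym3 F \<longleftrightarrow> (\<forall>a b c. F a b c = - F b a c \<and> F a b c = - F a c b)"

text \<open>Contravariant frame components of the dual of the three-form with frame components \<open>F\<close>; the
  sign is the normalization \<open>- sign \<pi>\<close> of the Levi-Civita tensor.\<close>

definition dual_comp :: "(6 \<Rightarrow> 6 \<Rightarrow> 6 \<Rightarrow> real) \<Rightarrow> 6 \<Rightarrow> 6 \<Rightarrow> 6 \<Rightarrow> real" where
  "dual_comp F a b c = - 1 / 6 * (\<Sum>\<pi> | \<pi> permutes UNIV. of_int (sign \<pi>) *
     (if \<pi> 0 = a \<and> \<pi> 1 = b \<and> \<pi> 2 = c then F (\<pi> 3) (\<pi> 4) (\<pi> 5) else 0))"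

text \<open>Contravariant frame components of \<open>p\<close> when \<open>v\<close> is the frame vector 0; the sign is that of
  \<open>- 1 / 8\<close>, the Levi-Civita normalization and \<open>v\<^sub>0 = -1\<close> combined.\<close>

definition p_comp :: "(6 \<Rightarrow> 6 \<Rightarrow> real) \<Rightarrow> 6 \<Rightarrow> real" where
  "p_comp X a = - 1 / 8 * (\<Sum>\<pi> | \<pi> permutes UNIV. of_int (sign \<pi>) *
     (if \<pi> 0 = a \<and> \<pi> 1 = 0 then X (\<pi> 2) (\<pi> 3) * X (\<pi> 4) (\<pi> 5) else 0))"

definition pfaffian :: "('a \<Rightarrow> 'a \<Rightarrow> real) \<Rightarrow> 'a \<Rightarrow> 'a \<Rightarrow> 'a \<Rightarrow> 'a \<Rightarrow> real" where
  "pfaffian X i j k l = X i j * X k l - X i k * X j l + X i l * X j k"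

abbreviation swap_fun :: "'a \<Rightarrow> 'a \<Rightarrow> 'a \<Rightarrow> 'a" where
  "swap_fun \<equiv> Transposition.transpose"

lemma permutes_sign_swap:
  assumes "q permutes (UNIV :: 'a::finite set)"
  shows "q \<circ> swap_fun a b permutes UNIV"
    and "sign (q \<circ> swap_fun a b) = (if a = b then 1 else -1) * sign q"
proof -
  show "q \<circ> swap_fun a b permutes UNIV"
    using assms by (intro permutes_compose permutes_swap_id) auto
  have "permutation q" using assms by (auto simp: permutation_permutes)
  then show "sign (q \<circ> swap_fun a b) = (if a = b then 1 else -1) * sign q"
    by (simp add: sign_compose sign_swap_id permutation_swap_id)
qed

lemma swap_fun_permutes: "swap_fun a b permutes UNIV"
  by (simp add: permutes_swap_id)

lemma permutes_sign_swap_left: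
  assumes "q permutes S" "a \<in> S" "b \<in> S" "finite S"
  shows "swap_fun a b \<circ> q permutes S"
    and "sign (swap_fun a b \<circ> q) = (if a = b then 1 else -1) * sign q"
proof -
  show "swap_fun a b \<circ> q permutes S"
    using assms by (intro permutes_compose permutes_swap_id)
  have "permutation q" using assms by (auto simp: permutation_permutes)
  then show "sign (swap_fun a b \<circ> q) = (if a = b then 1 else -1) * sign q"
    by (simp add: sign_compose sign_swap_id permutation_swap_id)
qed

text \<open>A permutation of the larger set is uniquely a swap of \<open>a\<close> with some
  \<open>b\<close> after a permutation of \<open>S\<close>. Iterating this recursion evaluates sums
  over three or four indices by rewriting.\<close>

lemma sum_sign_permutations_insert:
  fixes f :: "('a \<Rightarrow> 'a) \<Rightarrow> real"
  assumes S: "finite S" "a \<notin> S"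
  shows "(\<Sum>\<tau> | \<tau> permutes insert a S. of_int (sign \<tau>) * f \<tau>)
    = (\<Sum>b\<in>insert a S. (if a = b then 1 else -1) *
         (\<Sum>\<tau> | \<tau> permutes S. of_int (sign \<tau>) * f (swap_fun a b \<circ> \<tau>)))"
  unfolding sum_over_permutations_insert[OF S] sum_distrib_left
proof (intro sum.cong refl)
  fix b q assume "b \<in> insert a S" "q \<in> {\<tau>. \<tau> permutes S}"
  then have "sign (swap_fun a b \<circ> q) = (if a = b then 1 else -1) * sign q"
    using S by (intro permutes_sign_swap_left[of _ "insert a S"]) (auto intro: permutes_subset)
  then show "of_int (sign (swap_fun a b \<circ> q)) * f (swap_fun a b \<circ> q)
     = (if a = b then 1 else -1) * (of_int (sign q) * f (swap_fun a b \<circ> q))"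
    by simp
qed

text \<open>By antisymmetry the six arrangements of the remaining three indices contribute equally,
  which cancels the factor 1/6.\<close>

lemma dual_comp_permutation:
  assumes F: "antisym3 F" and \<sigma>: "\<sigma> permutes UNIV"
  shows "dual_comp F (\<sigma> 0) (\<sigma> 1) (\<sigma> 2) = - of_int (sign \<sigma>) * F (\<sigma> 3) (\<sigma> 4) (\<sigma> 5)"
proof -
  have F1: "F b a c = - F a b c" and F2: "F a c b = - F a b c" for a b c
    using F unfolding antisym3_def by (metis add.inverse_inverse)+
  \<comment> \<open>All orders are expressed through x, y, z. Fixing these to the three values of
    \<sigma> in the rewriting below gives the equations a direction.\<close>
  have F': "F x z y = - F x y z" "F y x z = - F x y z" "F y z x = F x y z"
    "F z x y = F x y z" "F z y x = - F x y z" for x y z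
    by (metis F1 F2 add.inverse_inverse)+
  have compl: "- {0, 1, 2} = {3, 4, 5 :: 6}"
    using UNIV_6 by auto
  have "(\<Sum>\<tau> | \<tau> permutes {3, 4, 5}. of_int (sign \<tau>) *
      F (\<sigma> (\<tau> 3)) (\<sigma> (\<tau> 4)) (\<sigma> (\<tau> 5))) = 6 * F (\<sigma> 3) (\<sigma> 4) (\<sigma> 5)"
    by (simp add: sum_sign_permutations_insert Transposition.transpose_def permutes_empty
        F'[where x = "\<sigma> 3" and y = "\<sigma> 4" and z = "\<sigma> 5"])
  then show ?thesis
    unfolding dual_comp_def
    using sum_permutations_fixing[OF \<sigma>, of "{0, 1, 2}" "\<lambda>\<pi>. F (\<pi> 3) (\<pi> 4) (\<pi> 5)"]
    by (simp add: compl)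
qed

text \<open>The 24 arrangements of four indices fall into the three pairings of a Pfaffian. Each
  pairing occurs eight times with one and the same signed value, which cancels the factor
  1/8.\<close>

lemma p_comp_permutation:
  assumes X: "antisym2 X" and \<sigma>: "\<sigma> permutes UNIV" and "\<sigma> 1 = 0"
  shows "p_comp X (\<sigma> 0) = - of_int (sign \<sigma>) * pfaffian X (\<sigma> 2) (\<sigma> 3) (\<sigma> 4) (\<sigma> 5)"
proof -
  have X': "X b a = - X a b" for a b
    using X unfolding antisym2_def by blast
  have X2: "X (\<sigma> 3) (\<sigma> 2) = - X (\<sigma> 2) (\<sigma> 3)" "X (\<sigma> 4) (\<sigma> 2) = - X (\<sigma> 2) (\<sigma> 4)"
    "X (\<sigma> 5) (\<sigma> 2) = - X (\<sigma> 2) (\<sigma> 5)" "X (\<sigma> 4) (\<sigma> 3) = - X (\<sigma> 3) (\<sigma> 4)"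
    "X (\<sigma> 5) (\<sigma> 3) = - X (\<sigma> 3) (\<sigma> 5)" "X (\<sigma> 5) (\<sigma> 4) = - X (\<sigma> 4) (\<sigma> 5)"
    by (rule X')+
  have compl: "- {0, 1} = {2, 3, 4, 5 :: 6}"
    using UNIV_6 by auto
  have "(\<Sum>\<tau> | \<tau> permutes {2, 3, 4, 5}. of_int (sign \<tau>) *
      (X (\<sigma> (\<tau> 2)) (\<sigma> (\<tau> 3)) * X (\<sigma> (\<tau> 4)) (\<sigma> (\<tau> 5)))) = 8 * pfaffian X (\<sigma> 2) (\<sigma> 3) (\<sigma> 4) (\<sigma> 5)"
    by (simp add: sum_sign_permutations_insert Transposition.transpose_def permutes_empty X2 pfaffian_def)
  then show ?thesis
    unfolding p_comp_def
    using sum_permutations_fixing[OF \<sigma>, of "{0, 1}" "\<lambda>\<pi>. X (\<pi> 2) (\<pi> 3) * X (\<pi> 4) (\<pi> 5)"] \<open>\<sigma> 1 = 0\<close>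
    by (simp add: compl)
qed

lemma p_comp_0: "p_comp X 0 = 0"
proof -
  have "\<not> (\<pi> 0 = 0 \<and> \<pi> 1 = 0)" if "\<pi> permutes UNIV" for \<pi> :: "6 \<Rightarrow> 6"
    using permutes_inj[OF that] by (metis injD zero_neq_one)
  then have "(\<Sum>\<pi> | \<pi> permutes UNIV. of_int (sign \<pi>) *
     (if \<pi> 0 = 0 \<and> \<pi> 1 = 0 then X (\<pi> 2) (\<pi> 3) * X (\<pi> 4) (\<pi> 5) else 0)) = 0"
    by (intro sum.neutral) auto
  then show ?thesis unfolding p_comp_def by simp
qed

text \<open>Each permutation lists the indices of the left side followed by those of the right side.
  Writing it as a product of transpositions makes its sign the parity of the number of
  factors.\<close>

lemma dual_comp_values:
  assumes "antisym3 F"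
  shows
    "dual_comp F 1 2 0 = - F 3 4 5"
    "dual_comp F 1 3 0 = F 2 4 5"
    "dual_comp F 1 4 0 = - F 2 3 5"
    "dual_comp F 1 5 0 = F 2 3 4"
    "dual_comp F 2 3 0 = - F 1 4 5"
    "dual_comp F 2 4 0 = F 1 3 5"
    "dual_comp F 2 5 0 = - F 1 3 4"
    "dual_comp F 3 4 0 = - F 1 2 5"
    "dual_comp F 3 5 0 = F 1 2 4"
    "dual_comp F 4 5 0 = - F 1 2 3"
    "dual_comp F 3 4 5 = F 1 2 0"
    "dual_comp F 2 4 5 = - F 1 3 0"
    "dual_comp F 2 3 5 = F 1 4 0"
    "dual_comp F 2 3 4 = - F 1 5 0"
    "dual_comp F 1 4 5 = F 2 3 0"
    "dual_comp F 1 3 5 = - F 2 4 0"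
    "dual_comp F 1 3 4 = F 2 5 0"
    "dual_comp F 1 2 5 = F 3 4 0"
    "dual_comp F 1 2 4 = - F 3 5 0"
    "dual_comp F 1 2 3 = F 4 5 0"
  using
    dual_comp_permutation[OF assms, of "swap_fun 0 1 \<circ> swap_fun 1 2"]
    dual_comp_permutation[OF assms, of "swap_fun 0 1 \<circ> swap_fun 1 3 \<circ> swap_fun 2 3"]
    dual_comp_permutation[OF assms, of "swap_fun 0 1 \<circ> swap_fun 1 4 \<circ> swap_fun 2 4 \<circ> swap_fun 3 4"]
    dual_comp_permutation[OF assms, of "swap_fun 0 1 \<circ> swap_fun 1 5 \<circ> swap_fun 2 5 \<circ> swap_fun 3 5 \<circ> swap_fun 4 5"]
    dual_comp_permutation[OF assms, of "swap_fun 0 2 \<circ> swap_fun 1 3"]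
    dual_comp_permutation[OF assms, of "swap_fun 0 2 \<circ> swap_fun 1 4 \<circ> swap_fun 3 4"]
    dual_comp_permutation[OF assms, of "swap_fun 0 2 \<circ> swap_fun 1 5 \<circ> swap_fun 3 5 \<circ> swap_fun 4 5"]
    dual_comp_permutation[OF assms, of "swap_fun 0 3 \<circ> swap_fun 1 4 \<circ> swap_fun 2 3 \<circ> swap_fun 3 4"]
    dual_comp_permutation[OF assms, of "swap_fun 0 3 \<circ> swap_fun 1 5 \<circ> swap_fun 2 3 \<circ> swap_fun 3 5 \<circ> swap_fun 4 5"]
    dual_comp_permutation[OF assms, of "swap_fun 0 4 \<circ> swap_fun 1 5 \<circ> swap_fun 2 4 \<circ> swap_fun 3 5"]
    dual_comp_permutation[OF assms, of "swap_fun 0 3 \<circ> swap_fun 1 4 \<circ> swap_fun 2 5 \<circ> swap_fun 3 4 \<circ> swap_fun 4 5"]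
    dual_comp_permutation[OF assms, of "swap_fun 0 2 \<circ> swap_fun 1 4 \<circ> swap_fun 2 5 \<circ> swap_fun 3 4"]
    dual_comp_permutation[OF assms, of "swap_fun 0 2 \<circ> swap_fun 1 3 \<circ> swap_fun 2 5"]
    dual_comp_permutation[OF assms, of "swap_fun 0 2 \<circ> swap_fun 1 3 \<circ> swap_fun 2 4 \<circ> swap_fun 4 5"]
    dual_comp_permutation[OF assms, of "swap_fun 0 1 \<circ> swap_fun 1 4 \<circ> swap_fun 2 5 \<circ> swap_fun 3 5 \<circ> swap_fun 4 5"]
    dual_comp_permutation[OF assms, of "swap_fun 0 1 \<circ> swap_fun 1 3 \<circ> swap_fun 2 5 \<circ> swap_fun 3 5"]
    dual_comp_permutation[OF assms, of "swap_fun 0 1 \<circ> swap_fun 1 3 \<circ> swap_fun 2 4 \<circ> swap_fun 3 4 \<circ> swap_fun 4 5"]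
    dual_comp_permutation[OF assms, of "swap_fun 0 1 \<circ> swap_fun 1 2 \<circ> swap_fun 2 5"]
    dual_comp_permutation[OF assms, of "swap_fun 0 1 \<circ> swap_fun 1 2 \<circ> swap_fun 2 4 \<circ> swap_fun 4 5"]
    dual_comp_permutation[OF assms, of "swap_fun 0 1 \<circ> swap_fun 1 2 \<circ> swap_fun 2 3 \<circ> swap_fun 3 4 \<circ> swap_fun 4 5"]
  by (simp_all add: permutes_sign_swap swap_fun_permutes sign_swap_id Transposition.transpose_def)

text \<open>A cyclic shift of five indices is even, so one formula with cyclically ordered indices
  gives every component with the same sign. Later identities therefore need a proof for one
  component only.\<close>

lemma p_comp_values:
  assumes "antisym2 X"
  shows
    "p_comp X 1 = pfaffian X 2 3 4 5"
    "p_comp X 2 = pfaffian X 3 4 5 1"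
    "p_comp X 3 = pfaffian X 4 5 1 2"
    "p_comp X 4 = pfaffian X 5 1 2 3"
    "p_comp X 5 = pfaffian X 1 2 3 4"
  using
    p_comp_permutation[OF assms, of "swap_fun 0 1"]
    p_comp_permutation[OF assms, of "swap_fun 0 2 \<circ> swap_fun 1 2 \<circ> swap_fun 2 3 \<circ> swap_fun 3 4 \<circ> swap_fun 4 5"]
    p_comp_permutation[OF assms, of "swap_fun 0 3 \<circ> swap_fun 1 3 \<circ> swap_fun 2 4 \<circ> swap_fun 3 5 \<circ> swap_fun 4 5"]
    p_comp_permutation[OF assms, of "swap_fun 0 4 \<circ> swap_fun 1 4 \<circ> swap_fun 2 5 \<circ> swap_fun 3 4 \<circ> swap_fun 4 5"]
    p_comp_permutation[OF assms, of "swap_fun 0 5 \<circ> swap_fun 1 5 \<circ> swap_fun 2 5 \<circ> swap_fun 3 5 \<circ> swap_fun 4 5"]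
  by (simp_all add: permutes_sign_swap swap_fun_permutes sign_swap_id Transposition.transpose_def)

section \<open>Algebra of spatial bivectors\<close>

text \<open>A rank on the indices that \<open>simp\<close> can evaluate; it orients antisymmetry into a terminating rewrite rule.\<close>

definition idx :: "6 \<Rightarrow> nat" where
  "idx a = (if a = 0 then 0 else if a = 1 then 1 else if a = 2 then 2 else if a = 3 then 3
     else if a = 4 then 4 else 5)"

lemma idx_values [simp]:
  "idx 0 = 0" "idx 1 = 1" "idx 2 = 2" "idx 3 = 3" "idx 4 = 4" "idx 5 = 5"
  by (simp_all add: idx_def)

lemma antisym2_order:
  assumes "antisym2 X"
  shows "idx b < idx a \<Longrightarrow> X a b = - X b a" "X a a = 0"
proof -
  have X: "X i j = - X j i" for i j
    using assms unfolding antisym2_def by blast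
  then show "X a b = - X b a" .
  show "X a a = 0" using X[of a a] by simp
qed

lemma antisym3_order:
  assumes "antisym3 F"
  shows "idx b < idx a \<Longrightarrow> F a b c = - F b a c" "idx c < idx b \<Longrightarrow> F a b c = - F a c b"
    "F a a c = 0" "F a b b = 0"
proof -
  have F1: "F i j k = - F j i k" and F2: "F i j k = - F i k j" for i j k
    using assms unfolding antisym3_def by blast+
  show "F a b c = - F b a c" "F a b c = - F a c b" by (rule F1 F2)+
  show "F a a c = 0" "F a b b = 0" using F1[of a a] F2[of _ b b] by simp_all
qed

lemma antisym2_contract_last:
  assumes "antisym3 F"
  shows "antisym2 (\<lambda>a b. F a b c)"
  using assms unfolding antisym2_def antisym3_def by blast

text \<open>Reindexing the sum by a transposition of two adjacent positions among 0, 1, 2 exchanges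
  the corresponding arguments, flips the sign of the permutation and leaves positions 3, 4, 5
  alone.\<close>

lemma antisym3_dual_comp: "antisym3 (dual_comp F)"
proof -
  have dc: "dual_comp F a b c = - 1 / 6 * (\<Sum>\<pi> | \<pi> permutes UNIV. of_int (sign (\<pi> \<circ> swap_fun i j)) *
     (if (\<pi> \<circ> swap_fun i j) 0 = a \<and> (\<pi> \<circ> swap_fun i j) 1 = b \<and> (\<pi> \<circ> swap_fun i j) 2 = c
      then F ((\<pi> \<circ> swap_fun i j) 3) ((\<pi> \<circ> swap_fun i j) 4) ((\<pi> \<circ> swap_fun i j) 5) else 0))" for a b c i j
    unfolding dual_comp_def
    by (subst sum_permutations_compose_right[OF swap_fun_permutes[of i j]]) (rule refl)
  have 1: "dual_comp F a b c = - dual_comp F b a c" for a b c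
    unfolding dc[of a b c 0 1] unfolding dual_comp_def
    by (simp add: sum_negf[symmetric] permutes_sign_swap Transposition.transpose_def cong: sum.cong)
       (intro sum.cong refl; auto simp: permutes_sign_swap)
  have 2: "dual_comp F a b c = - dual_comp F a c b" for a b c
    unfolding dc[of a b c 1 2] unfolding dual_comp_def
    by (simp add: sum_negf[symmetric] permutes_sign_swap Transposition.transpose_def cong: sum.cong)
       (intro sum.cong refl; auto simp: permutes_sign_swap)
  show ?thesis
    unfolding antisym3_def using 1 2 by blast
qed

text \<open>The polar form without a factor 1/2: it is the coefficient of t in \<open>p_comp\<close>
  at X + t Y, hence the derivative of \<open>p_comp\<close> at X in the direction Y.\<close>

definition p_polar :: "(6 \<Rightarrow> 6 \<Rightarrow> real) \<Rightarrow> (6 \<Rightarrow> 6 \<Rightarrow> real) \<Rightarrow> 6 \<Rightarrow> real" where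
  "p_polar X Y a = p_comp (\<lambda>i j. X i j + Y i j) a - p_comp X a - p_comp Y a"

text \<open>The counterpart of \<open>unit_bivector\<close> for the frame, with both indices lowered
  and the same normalization by 1/2.\<close>

definition frame_bivector :: "6 \<Rightarrow> 6 \<Rightarrow> 6 \<Rightarrow> 6 \<Rightarrow> real" where
  "frame_bivector c d a b = (minkowski a c * minkowski b d - minkowski a d * minkowski b c) / 2"

text \<open>The frame components of \<open>2 p \<partial>p/\<partial>B\<close>, that is, of \<open>2 s B + B\<^sup>3\<close>.\<close>

definition cubic :: "(6 \<Rightarrow> 6 \<Rightarrow> real) \<Rightarrow> 6 \<Rightarrow> 6 \<Rightarrow> real" where
  "cubic X c d = 2 * (\<Sum>a\<in>UNIV. p_comp X a * p_polar X (frame_bivector c d) a)"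

lemma antisym2_add:
  "antisym2 X \<Longrightarrow> antisym2 Y \<Longrightarrow> antisym2 (\<lambda>i j. X i j + Y i j)"
  unfolding antisym2_def by (metis minus_add_distrib)

lemma antisym2_frame_bivector: "antisym2 (frame_bivector c d)"
  unfolding antisym2_def frame_bivector_def by (simp add: field_simps)

lemma p_polar_values:
  assumes "antisym2 X" "antisym2 Y"
  shows
    "p_polar X Y 1 = X 2 3 * Y 4 5 + Y 2 3 * X 4 5 - X 2 4 * Y 3 5 - Y 2 4 * X 3 5 + X 2 5 * Y 3 4 + Y 2 5 * X 3 4"
    "p_polar X Y 2 = X 3 4 * Y 5 1 + Y 3 4 * X 5 1 - X 3 5 * Y 4 1 - Y 3 5 * X 4 1 + X 3 1 * Y 4 5 + Y 3 1 * X 4 5"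
    "p_polar X Y 3 = X 4 5 * Y 1 2 + Y 4 5 * X 1 2 - X 4 1 * Y 5 2 - Y 4 1 * X 5 2 + X 4 2 * Y 5 1 + Y 4 2 * X 5 1"
    "p_polar X Y 4 = X 5 1 * Y 2 3 + Y 5 1 * X 2 3 - X 5 2 * Y 1 3 - Y 5 2 * X 1 3 + X 5 3 * Y 1 2 + Y 5 3 * X 1 2"
    "p_polar X Y 5 = X 1 2 * Y 3 4 + Y 1 2 * X 3 4 - X 1 3 * Y 2 4 - Y 1 3 * X 2 4 + X 1 4 * Y 2 3 + Y 1 4 * X 2 3"
    "p_polar X Y 0 = 0"
  by (simp_all add: p_polar_def p_comp_values assms antisym2_add p_comp_0 pfaffian_def algebra_simps)

lemma p_polar_lincomb:
  assumes X: "antisym2 X" and Y: "antisym2 Y" and Z: "antisym2 Z"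
  shows "p_polar X (\<lambda>i j. c * Y i j + d * Z i j) a = c * p_polar X Y a + d * p_polar X Z a"
proof -
  have "Y i j = - Y j i" "Z i j = - Z j i" for i j
    using Y Z unfolding antisym2_def by blast+
  then have "antisym2 (\<lambda>i j. c * Y i j + d * Z i j)"
    unfolding antisym2_def by (metis minus_add_distrib mult_minus_right)
  then have "\<forall>a\<in>{0, 1, 2, 3, 4, 5}. p_polar X (\<lambda>i j. c * Y i j + d * Z i j) a
      = c * p_polar X Y a + d * p_polar X Z a"
    by (simp add: p_polar_values X Y Z algebra_simps)
  then show ?thesis using UNIV_6 by blast
qed

lemma p_comp_add_scaled:
  assumes X: "antisym2 X" and Y: "antisym2 Y"
  shows "p_comp (\<lambda>i j. X i j + t * Y i j) a = p_comp X a + t * p_polar X Y a + t\<^sup>2 * p_comp Y a"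
proof -
  have "Y i j = - Y j i" "X i j = - X j i" for i j
    using X Y unfolding antisym2_def by blast+
  then have "antisym2 (\<lambda>i j. X i j + t * Y i j)"
    unfolding antisym2_def by (metis minus_add_distrib mult_minus_right)
  then have "\<forall>a\<in>{0, 1, 2, 3, 4, 5}. p_comp (\<lambda>i j. X i j + t * Y i j) a
      = p_comp X a + t * p_polar X Y a + t\<^sup>2 * p_comp Y a"
    by (simp add: p_polar_values p_comp_values p_comp_0 X Y pfaffian_def algebra_simps power2_eq_square)
  then show ?thesis using UNIV_6 by blast
qed

text \<open>These formulas identify \<open>cubic X\<close> with the spatial Hodge dual of the wedge
  product of the vector \<open>p_comp X\<close> with X. The sub-Pfaffians stay unexpanded on the
  right so that later computations can treat them as unknowns.\<close>

lemma cubic_values: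
  assumes "antisym2 X"
  shows
    "cubic X 1 2 = p_comp X 3 * X 4 5 + p_comp X 4 * X 5 3 + p_comp X 5 * X 3 4"
    "cubic X 1 3 = p_comp X 2 * X 5 4 + p_comp X 5 * X 4 2 + p_comp X 4 * X 2 5"
    "cubic X 1 4 = p_comp X 2 * X 3 5 + p_comp X 3 * X 5 2 + p_comp X 5 * X 2 3"
    "cubic X 1 5 = p_comp X 2 * X 4 3 + p_comp X 4 * X 3 2 + p_comp X 3 * X 2 4"
    "cubic X 2 3 = p_comp X 1 * X 4 5 + p_comp X 4 * X 5 1 + p_comp X 5 * X 1 4"
    "cubic X 2 4 = p_comp X 1 * X 5 3 + p_comp X 5 * X 3 1 + p_comp X 3 * X 1 5"
    "cubic X 2 5 = p_comp X 1 * X 3 4 + p_comp X 3 * X 4 1 + p_comp X 4 * X 1 3"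
    "cubic X 3 4 = p_comp X 1 * X 2 5 + p_comp X 2 * X 5 1 + p_comp X 5 * X 1 2"
    "cubic X 3 5 = p_comp X 1 * X 4 2 + p_comp X 4 * X 2 1 + p_comp X 2 * X 1 4"
    "cubic X 4 5 = p_comp X 1 * X 2 3 + p_comp X 2 * X 3 1 + p_comp X 3 * X 1 2"
  by (simp_all add: cubic_def sum_6 p_polar_values assms antisym2_frame_bivector
      frame_bivector_def minkowski_def antisym2_order[OF assms] algebra_simps)

lemma antisym2_cubic:
  assumes "antisym2 X"
  shows "antisym2 (cubic X)"
proof -
  have swap: "p_polar X (frame_bivector d c) a = - p_polar X (frame_bivector c d) a" for c d a
  proof -
    \<comment> \<open>The zero second summand brings the negative into the shape of
      \<open>p_polar_lincomb\<close>.\<close>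
    have "frame_bivector d c = (\<lambda>i j. (-1) * frame_bivector c d i j + 0 * frame_bivector c d i j)"
      unfolding fun_eq_iff frame_bivector_def by simp
    then have "p_polar X (frame_bivector d c) a
        = p_polar X (\<lambda>i j. (-1) * frame_bivector c d i j + 0 * frame_bivector c d i j) a"
      by (rule arg_cong)
    also have "\<dots> = - p_polar X (frame_bivector c d) a"
      unfolding p_polar_lincomb[OF assms antisym2_frame_bivector antisym2_frame_bivector] by simp
    finally show ?thesis .
  qed
  have "cubic X c d = - cubic X d c" for c d
    unfolding cubic_def swap[of c d] by (simp add: sum_negf)
  then show ?thesis
    unfolding antisym2_def by blast
qed

definition spatial_sq :: "(6 \<Rightarrow> 6 \<Rightarrow> real) \<Rightarrow> real" where
  "spatial_sq X = (X 1 2)\<^sup>2 + (X 1 3)\<^sup>2 + (X 1 4)\<^sup>2 + (X 1 5)\<^sup>2 + (X 2 3)\<^sup>2 + (X 2 4)\<^sup>2 + (X 2 5)\<^sup>2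
    + (X 3 4)\<^sup>2 + (X 3 5)\<^sup>2 + (X 4 5)\<^sup>2"

text \<open>Geometrically, turn axis 1 along P. As X annihilates P, it lives on the orthogonal
  four-space, where N is P1 times the dual of X. A 4x4 Pfaffian is unchanged by duality and
  quadratic, so that of N is P1^2 times P1. The statement is about plain reals, so that it can be
  instantiated with shifted indices.\<close>

lemma pfaffian_cubic:
  fixes x12 x13 x14 x15 x23 x24 x25 x34 x35 x45 :: real
  assumes P: "P1 = x23 * x45 - x24 * x35 + x25 * x34" "P2 = - x34 * x15 + x35 * x14 - x13 * x45"
      "P3 = x45 * x12 - x14 * x25 + x24 * x15" "P4 = - x15 * x23 + x25 * x13 - x35 * x12"
      "P5 = x12 * x34 - x13 * x24 + x14 * x23"
    and n: "n23 = - P4 * x15 + P5 * x14 + P1 * x45" "n24 = P3 * x15 - P1 * x35 - P5 * x13"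
      "n25 = P1 * x34 - P3 * x14 + P4 * x13" "n34 = P1 * x25 - P2 * x15 + P5 * x12"
      "n35 = - P1 * x24 - P4 * x12 + P2 * x14" "n45 = P1 * x23 - P2 * x13 + P3 * x12"
  shows "n23 * n45 - n24 * n35 + n25 * n34 = (P1\<^sup>2 + P2\<^sup>2 + P3\<^sup>2 + P4\<^sup>2 + P5\<^sup>2) * P1"
proof -
  \<comment> \<open>The vector of sub-Pfaffians is in the kernel of the matrix.\<close>
  have "P2 * x12 + P3 * x13 + P4 * x14 + P5 * x15 = 0"
    "- P1 * x12 + P3 * x23 + P4 * x24 + P5 * x25 = 0"
    "- P1 * x13 - P2 * x23 + P4 * x34 + P5 * x35 = 0"
    "- P1 * x14 - P2 * x24 - P3 * x34 + P5 * x45 = 0"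
    "- P1 * x15 - P2 * x25 - P3 * x35 - P4 * x45 = 0"
    unfolding P by (simp_all add: algebra_simps)
  then show ?thesis
    using P unfolding n by algebra
qed

text \<open>With P along an axis, N is |P| times the four-dimensional dual of X. The polar form of
  the Pfaffian pairs a bivector with its dual into a sum of squares, which explains the factor
  \<open>spatial_sq X\<close> in the first identity.\<close>

lemma p_comp_cubic:
  assumes X: "antisym2 X" and a: "a \<in> {1, 2, 3, 4, 5}"
  shows "p_polar X (cubic X) a = spatial_sq X * p_comp X a"
    and "p_comp (cubic X) a = ((p_comp X 1)\<^sup>2 + (p_comp X 2)\<^sup>2 + (p_comp X 3)\<^sup>2 + (p_comp X 4)\<^sup>2
       + (p_comp X 5)\<^sup>2) * p_comp X a"
proof -
  note N = antisym2_cubic[OF X]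
  note ord = antisym2_order[OF X] antisym2_order[OF N]
  have "p_polar X (cubic X) 1 = spatial_sq X * p_comp X 1" "p_polar X (cubic X) 2 = spatial_sq X * p_comp X 2"
    "p_polar X (cubic X) 3 = spatial_sq X * p_comp X 3" "p_polar X (cubic X) 4 = spatial_sq X * p_comp X 4"
    "p_polar X (cubic X) 5 = spatial_sq X * p_comp X 5"
    by (simp_all add: p_polar_values[OF X N] cubic_values[OF X] p_comp_values[OF X] pfaffian_def ord
        spatial_sq_def algebra_simps power2_eq_square)
  then show "p_polar X (cubic X) a = spatial_sq X * p_comp X a"
    using a by auto
  let ?S = "(p_comp X 1)\<^sup>2 + (p_comp X 2)\<^sup>2 + (p_comp X 3)\<^sup>2 + (p_comp X 4)\<^sup>2 + (p_comp X 5)\<^sup>2"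
  note P = p_comp_values[OF X, unfolded pfaffian_def]
  have 1: "cubic X 2 3 * cubic X 4 5 - cubic X 2 4 * cubic X 3 5 + cubic X 2 5 * cubic X 3 4
      = ((p_comp X 1)\<^sup>2 + (p_comp X 2)\<^sup>2 + (p_comp X 3)\<^sup>2 + (p_comp X 4)\<^sup>2 + (p_comp X 5)\<^sup>2) * p_comp X 1"
    by (rule pfaffian_cubic[where ?x12.0 = "X 1 2" and ?x13.0 = "X 1 3" and ?x14.0 = "X 1 4" and ?x15.0 = "X 1 5"
        and ?x23.0 = "X 2 3" and ?x24.0 = "X 2 4" and ?x25.0 = "X 2 5" and ?x34.0 = "X 3 4" and ?x35.0 = "X 3 5" and ?x45.0 = "X 4 5"
        and ?P1.0 = "p_comp X 1" and ?P2.0 = "p_comp X 2" and ?P3.0 = "p_comp X 3" and ?P4.0 = "p_comp X 4" and ?P5.0 = "p_comp X 5"])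
      (simp_all add: cubic_values[OF X] ord algebra_simps, simp_all add: P ord algebra_simps)
  \<comment> \<open>This and the next three are the first component with the indices 1, ..., 5
    shifted cyclically. Entries such as \<open>X 2 1\<close> appear out of order because of the
    shift.\<close>
  have 2: "cubic X 3 4 * cubic X 5 1 - cubic X 3 5 * cubic X 4 1 + cubic X 3 1 * cubic X 4 5
      = ((p_comp X 2)\<^sup>2 + (p_comp X 3)\<^sup>2 + (p_comp X 4)\<^sup>2 + (p_comp X 5)\<^sup>2 + (p_comp X 1)\<^sup>2) * p_comp X 2"
    by (rule pfaffian_cubic[where ?x12.0 = "X 2 3" and ?x13.0 = "X 2 4" and ?x14.0 = "X 2 5" and ?x15.0 = "X 2 1"
        and ?x23.0 = "X 3 4" and ?x24.0 = "X 3 5" and ?x25.0 = "X 3 1" and ?x34.0 = "X 4 5" and ?x35.0 = "X 4 1" and ?x45.0 = "X 5 1"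
        and ?P1.0 = "p_comp X 2" and ?P2.0 = "p_comp X 3" and ?P3.0 = "p_comp X 4" and ?P4.0 = "p_comp X 5" and ?P5.0 = "p_comp X 1"])
      (simp_all add: cubic_values[OF X] ord algebra_simps, simp_all add: P ord algebra_simps)
  have 3: "cubic X 4 5 * cubic X 1 2 - cubic X 4 1 * cubic X 5 2 + cubic X 4 2 * cubic X 5 1
      = ((p_comp X 3)\<^sup>2 + (p_comp X 4)\<^sup>2 + (p_comp X 5)\<^sup>2 + (p_comp X 1)\<^sup>2 + (p_comp X 2)\<^sup>2) * p_comp X 3"
    by (rule pfaffian_cubic[where ?x12.0 = "X 3 4" and ?x13.0 = "X 3 5" and ?x14.0 = "X 3 1" and ?x15.0 = "X 3 2"
        and ?x23.0 = "X 4 5" and ?x24.0 = "X 4 1" and ?x25.0 = "X 4 2" and ?x34.0 = "X 5 1" and ?x35.0 = "X 5 2" and ?x45.0 = "X 1 2"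
        and ?P1.0 = "p_comp X 3" and ?P2.0 = "p_comp X 4" and ?P3.0 = "p_comp X 5" and ?P4.0 = "p_comp X 1" and ?P5.0 = "p_comp X 2"])
      (simp_all add: cubic_values[OF X] ord algebra_simps, simp_all add: P ord algebra_simps)
  have 4: "cubic X 5 1 * cubic X 2 3 - cubic X 5 2 * cubic X 1 3 + cubic X 5 3 * cubic X 1 2
      = ((p_comp X 4)\<^sup>2 + (p_comp X 5)\<^sup>2 + (p_comp X 1)\<^sup>2 + (p_comp X 2)\<^sup>2 + (p_comp X 3)\<^sup>2) * p_comp X 4"
    by (rule pfaffian_cubic[where ?x12.0 = "X 4 5" and ?x13.0 = "X 4 1" and ?x14.0 = "X 4 2" and ?x15.0 = "X 4 3"
        and ?x23.0 = "X 5 1" and ?x24.0 = "X 5 2" and ?x25.0 = "X 5 3" and ?x34.0 = "X 1 2" and ?x35.0 = "X 1 3" and ?x45.0 = "X 2 3"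
        and ?P1.0 = "p_comp X 4" and ?P2.0 = "p_comp X 5" and ?P3.0 = "p_comp X 1" and ?P4.0 = "p_comp X 2" and ?P5.0 = "p_comp X 3"])
      (simp_all add: cubic_values[OF X] ord algebra_simps, simp_all add: P ord algebra_simps)
  have 5: "cubic X 1 2 * cubic X 3 4 - cubic X 1 3 * cubic X 2 4 + cubic X 1 4 * cubic X 2 3
      = ((p_comp X 5)\<^sup>2 + (p_comp X 1)\<^sup>2 + (p_comp X 2)\<^sup>2 + (p_comp X 3)\<^sup>2 + (p_comp X 4)\<^sup>2) * p_comp X 5"
    by (rule pfaffian_cubic[where ?x12.0 = "X 5 1" and ?x13.0 = "X 5 2" and ?x14.0 = "X 5 3" and ?x15.0 = "X 5 4"
        and ?x23.0 = "X 1 2" and ?x24.0 = "X 1 3" and ?x25.0 = "X 1 4" and ?x34.0 = "X 2 3" and ?x35.0 = "X 2 4" and ?x45.0 = "X 3 4"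
        and ?P1.0 = "p_comp X 5" and ?P2.0 = "p_comp X 1" and ?P3.0 = "p_comp X 2" and ?P4.0 = "p_comp X 3" and ?P5.0 = "p_comp X 4"])
      (simp_all add: cubic_values[OF X] ord algebra_simps, simp_all add: P ord algebra_simps)
  show "p_comp (cubic X) a = ?S * p_comp X a"
    using a 1 2 3 4 5 by (auto simp: p_comp_values[OF N] pfaffian_def algebra_simps)
qed

section \<open>The self-duality condition in frame components\<close>

text \<open>Index 0 in the last slot is contraction with v. The components of the dual are
  contravariant and those of X covariant, so lowering the index 0 produces the minus sign. The
  constant \<open>k\<close> stands for \<open>hp / p\<close> and keeps the equations free of
  division.\<close>

locale self_dual_components =
  fixes F :: "6 \<Rightarrow> 6 \<Rightarrow> 6 \<Rightarrow> real" and X :: "6 \<Rightarrow> 6 \<Rightarrow> real" and hs hp k s p :: real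
  assumes F: "antisym3 F"
    and X: "\<And>a b. X a b = - (minkowski a a * minkowski b b) * dual_comp F a b 0"
    and self_dual: "\<And>a b. F a b 0 = hs * X a b + k * cubic X a b"
    and s: "s = 1 / 4 * (\<Sum>a\<in>UNIV. \<Sum>b\<in>UNIV. minkowski a a * minkowski b b * X a b * X a b)"
    and p: "p\<^sup>2 = (\<Sum>a\<in>UNIV. minkowski a a * p_comp X a * p_comp X a)"
    and hp: "hp = k * p"
    and pde: "hs\<^sup>2 + 2 * s * hs * k + hp\<^sup>2 = 1"
begin

lemma antisym_X: "antisym2 X"
proof -
  have "dual_comp F a b 0 = - dual_comp F b a 0" for a b
    using antisym3_dual_comp[of F] unfolding antisym3_def by blast
  then show ?thesis
    unfolding antisym2_def X by (metis mult.commute mult_minus_right)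
qed

lemmas X_order = antisym2_order[OF antisym_X]
lemmas F_order = antisym3_order[OF F]
lemmas D_order = antisym3_order[OF antisym3_dual_comp[of F]]

lemma X_0: "X a 0 = 0" "X 0 a = 0"
proof -
  have D: "dual_comp F a b c = - dual_comp F b a c" "dual_comp F a b c = - dual_comp F a c b" for a b c
    using antisym3_dual_comp[of F] unfolding antisym3_def by blast+
  show "X a 0 = 0" using D(2)[of a 0 0] by (simp add: X)
  then show "X 0 a = 0" using antisym_X unfolding antisym2_def by (metis add.inverse_neutral)
qed

lemma F_spatial:
  "F 3 4 5 = X 1 2" "F 2 4 5 = - X 1 3" "F 2 3 5 = X 1 4" "F 2 3 4 = - X 1 5" "F 1 4 5 = X 2 3"
  "F 1 3 5 = - X 2 4" "F 1 3 4 = X 2 5" "F 1 2 5 = X 3 4" "F 1 2 4 = - X 3 5" "F 1 2 3 = X 4 5"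
  unfolding X by (simp_all add: dual_comp_values[OF F] minkowski_def)

lemma D_mixed:
  "dual_comp F 1 2 0 = - X 1 2" "dual_comp F 1 3 0 = - X 1 3" "dual_comp F 1 4 0 = - X 1 4"
  "dual_comp F 1 5 0 = - X 1 5" "dual_comp F 2 3 0 = - X 2 3" "dual_comp F 2 4 0 = - X 2 4"
  "dual_comp F 2 5 0 = - X 2 5" "dual_comp F 3 4 0 = - X 3 4" "dual_comp F 3 5 0 = - X 3 5"
  "dual_comp F 4 5 0 = - X 4 5"
  unfolding X by (simp_all add: minkowski_def)

lemma s_sq: "2 * s = spatial_sq X"
  unfolding s spatial_sq_def by (simp add: sum_6 minkowski_def X_0 X_order power2_eq_square)

lemma p_sq: "p\<^sup>2 = (p_comp X 1)\<^sup>2 + (p_comp X 2)\<^sup>2 + (p_comp X 3)\<^sup>2 + (p_comp X 4)\<^sup>2 + (p_comp X 5)\<^sup>2"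
  unfolding p by (simp add: sum_6 minkowski_def p_comp_0 power2_eq_square)

definition E :: "6 \<Rightarrow> 6 \<Rightarrow> real" where
  "E a b = F a b 0"

lemma E: "E = (\<lambda>a b. hs * X a b + k * cubic X a b)"
  by (simp add: fun_eq_iff E_def self_dual)

lemma antisym_E: "antisym2 E"
  unfolding E_def by (rule antisym2_contract_last[OF F])

lemmas E_order = antisym2_order[OF antisym_E]

text \<open>Expand the quadratic map at hs X + k N; its three terms are the three terms of the
  differential equation times P. This is the only place where that equation enters.\<close>

lemma p_comp_E:
  assumes a: "a \<in> {1, 2, 3, 4, 5}"
  shows "p_comp E a = p_comp X a"
proof -
  note N = antisym2_cubic[OF antisym_X]
  have "p_comp E a = hs\<^sup>2 * p_comp X a + hs * k * p_polar X (cubic X) a + k\<^sup>2 * p_comp (cubic X) a"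
  proof -
    have "\<forall>a\<in>{1, 2, 3, 4, 5}. p_comp E a
      = hs\<^sup>2 * p_comp X a + hs * k * p_polar X (cubic X) a + k\<^sup>2 * p_comp (cubic X) a"
      by (simp add: p_comp_values[OF antisym_X] p_comp_values[OF antisym_E] p_comp_values[OF N]
          p_polar_values[OF antisym_X N] pfaffian_def E[THEN fun_cong, THEN fun_cong] algebra_simps power2_eq_square)
    then show ?thesis using a by blast
  qed
  also have "\<dots> = (hs\<^sup>2 + 2 * s * hs * k + hp\<^sup>2) * p_comp X a"
    unfolding p_comp_cubic[OF antisym_X a] s_sq p_sq[symmetric] hp
    by (simp add: algebra_simps power2_eq_square)
  finally show ?thesis by (simp add: pde)
qed

text \<open>Euler's relation for s and p, both homogeneous of degree two in B. The sum runs over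
  index pairs in increasing order and is therefore half of the full contraction.\<close>

lemma contraction_EX:
  "E 1 2 * X 1 2 + E 1 3 * X 1 3 + E 1 4 * X 1 4 + E 1 5 * X 1 5 + E 2 3 * X 2 3 + E 2 4 * X 2 4
    + E 2 5 * X 2 5 + E 3 4 * X 3 4 + E 3 5 * X 3 5 + E 4 5 * X 4 5 = 2 * (s * hs + p * hp)"
    (is "?EX = _")
proof -
  let ?C = "cubic X 1 2 * X 1 2 + cubic X 1 3 * X 1 3 + cubic X 1 4 * X 1 4 + cubic X 1 5 * X 1 5
    + cubic X 2 3 * X 2 3 + cubic X 2 4 * X 2 4 + cubic X 2 5 * X 2 5 + cubic X 3 4 * X 3 4
    + cubic X 3 5 * X 3 5 + cubic X 4 5 * X 4 5"
  have "?EX = hs * spatial_sq X + k * ?C"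
    unfolding E spatial_sq_def by (simp add: algebra_simps power2_eq_square)
  also have "?C = 2 * p\<^sup>2"
    unfolding p_sq
    by (simp add: cubic_values[OF antisym_X] p_comp_values[OF antisym_X] pfaffian_def X_order
        algebra_simps power2_eq_square)
  finally show ?thesis
    by (simp add: s_sq[symmetric] hp algebra_simps power2_eq_square)
qed

lemma E_0: "E 0 a = 0" "E a 0 = 0"
proof -
  show "E a 0 = 0" using F unfolding antisym3_def E_def by (metis neg_equal_zero)
  then show "E 0 a = 0" using antisym_E unfolding antisym2_def by (metis neg_equal_0_iff_equal)
qed

text \<open>E is a combination of X and X^3, hence commutes with X; for two antisymmetric matrices
  this is the symmetry of their product. With N given through sub-Pfaffians, the spatial entries are
  compared one by one.\<close>

lemma E_X_commute:
  "(\<Sum>c\<in>UNIV. E a c * X b c) = (\<Sum>c\<in>UNIV. E b c * X a c)"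
proof -
  note N = antisym2_cubic[OF antisym_X]
  define C where "C a b = (\<Sum>c\<in>UNIV. cubic X a c * X b c)" for a b
  note C_simps = C_def sum_6 X_0 X_order antisym2_order[OF N] cubic_values[OF antisym_X]
  have "C 1 2 = C 2 1" "C 1 3 = C 3 1" "C 1 4 = C 4 1" "C 1 5 = C 5 1" "C 2 3 = C 3 2"
    "C 2 4 = C 4 2" "C 2 5 = C 5 2" "C 3 4 = C 4 3" "C 3 5 = C 5 3" "C 4 5 = C 5 4"
    by (simp_all add: C_simps, simp_all add: p_comp_values[OF antisym_X] pfaffian_def X_order algebra_simps)
  then have C: "C a b = C b a" if "a \<in> {1, 2, 3, 4, 5}" "b \<in> {1, 2, 3, 4, 5}" for a b
    using that by auto
  have EX: "(\<Sum>c\<in>UNIV. E a c * X b c) = hs * (\<Sum>c\<in>UNIV. X a c * X b c) + k * C a b" for a b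
    unfolding E C_def by (simp add: algebra_simps sum.distrib sum_distrib_left)
  have XX: "(\<Sum>c\<in>UNIV. X a c * X b c) = (\<Sum>c\<in>UNIV. X b c * X a c)" for a b
    by (simp add: mult.commute)
  have spatial: "a = 0 \<or> a \<in> {1, 2, 3, 4, 5}" for a :: 6
    using UNIV_6 by blast
  show ?thesis
  proof (cases "a = 0 \<or> b = 0")
    case True
    then show ?thesis by (auto simp: X_0 E_0)
  next
    case False
    then show ?thesis
      unfolding EX using C[of a b] XX[of a b] spatial[of a] spatial[of b] by simp
  qed
qed

lemma dual_comp_spatial:
  "dual_comp F 3 4 5 = E 1 2" "dual_comp F 2 4 5 = - E 1 3" "dual_comp F 2 3 5 = E 1 4"
  "dual_comp F 2 3 4 = - E 1 5" "dual_comp F 1 4 5 = E 2 3" "dual_comp F 1 3 5 = - E 2 4"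
  "dual_comp F 1 3 4 = E 2 5" "dual_comp F 1 2 5 = E 3 4" "dual_comp F 1 2 4 = - E 3 5"
  "dual_comp F 1 2 3 = E 4 5"
  by (simp_all add: dual_comp_values[OF F] E_def)

lemma F_time: "F 0 a b = E a b"
  using F unfolding antisym3_def E_def by metis

lemma D_time: "dual_comp F 0 a b = dual_comp F a b 0"
  using antisym3_dual_comp[of F] unfolding antisym3_def by metis

section \<open>The product of F with its dual, block by block\<close>

definition FF :: "6 \<Rightarrow> 6 \<Rightarrow> real" where
  "FF a b = (\<Sum>d\<in>UNIV. \<Sum>e\<in>UNIV. F d e a * (minkowski b b * dual_comp F b d e))"

definition W :: "6 \<Rightarrow> 6 \<Rightarrow> real" where
  "W a b = (\<Sum>c\<in>UNIV. E a c * X b c)"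

lemma W_commute: "W a b = W b a"
  unfolding W_def by (rule E_X_commute)

lemmas component_simps = sum_6 minkowski_def F_order D_order F_time D_mixed[folded D_time] F_spatial
  dual_comp_spatial E_0 X_0 E_order X_order

lemma FF_time_time: "FF 0 0 = 4 * (s * hs + p * hp)"
  using contraction_EX by (simp add: FF_def component_simps algebra_simps)

text \<open>One order of the indices pairs E with the spatial part of the dual, which is made of E
  again; the other pairs the spatial part of F, made of X, with X. Each pairing is four times a
  vector of sub-Pfaffians.\<close>

lemma FF_time_space:
  assumes "a \<in> {1, 2, 3, 4, 5}"
  shows "FF 0 a + FF a 0 = 8 * p_comp X a"
proof -
  have "FF 0 a + FF a 0 = 4 * p_comp E a + 4 * p_comp X a"
    using assms by (elim insertE emptyE; hypsubst)
      (simp_all add: FF_def component_simps p_comp_values[OF antisym_X] p_comp_values[OF antisym_E]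
        pfaffian_def algebra_simps)
  then show ?thesis by (simp add: p_comp_E[OF assms])
qed

text \<open>Half of the term in \<open>W\<close> comes from summands in which one of the contracted
  indices is 0, the other half from contracting the two spatial Levi-Civita symbols. The latter also
  gives the trace term.\<close>

lemma FF_space_space:
  assumes "a \<in> {1, 2, 3, 4, 5}" "b \<in> {1, 2, 3, 4, 5}"
  shows "FF a b = 4 * (s * hs + p * hp) * minkowski a b - 4 * W a b"
proof -
  have "FF a b = 2 * (E 1 2 * X 1 2 + E 1 3 * X 1 3 + E 1 4 * X 1 4 + E 1 5 * X 1 5 + E 2 3 * X 2 3
    + E 2 4 * X 2 4 + E 2 5 * X 2 5 + E 3 4 * X 3 4 + E 3 5 * X 3 5 + E 4 5 * X 4 5) * minkowski a b
    - 4 * W a b"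
    using assms by (elim insertE emptyE; hypsubst)
      (simp_all add: FF_def W_def component_simps)
  then show ?thesis unfolding contraction_EX by simp
qed

lemma contraction_HB:
  "(\<Sum>a\<in>UNIV. \<Sum>b\<in>UNIV. minkowski a a * minkowski b b * E a b * X a b) = 4 * (s * hs + p * hp)"
proof -
  have "(\<Sum>a\<in>UNIV. \<Sum>b\<in>UNIV. minkowski a a * minkowski b b * E a b * X a b)
    = 2 * (E 1 2 * X 1 2 + E 1 3 * X 1 3 + E 1 4 * X 1 4 + E 1 5 * X 1 5 + E 2 3 * X 2 3
    + E 2 4 * X 2 4 + E 2 5 * X 2 5 + E 3 4 * X 3 4 + E 3 5 * X 3 5 + E 4 5 * X 4 5)"
    by (simp add: component_simps)
  then show ?thesis unfolding contraction_EX by simp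
qed

text \<open>The factor 1/8 combines 1/4 with the 1/2 of symmetrization. In the purely spatial block
  the symmetry of \<open>W\<close> merges the two orders of the indices; in the time-space blocks
  only p survives on the left.\<close>

lemma pst_components:
  fixes h :: real
  defines "HB \<equiv> (\<Sum>a\<in>UNIV. \<Sum>b\<in>UNIV. minkowski a a * minkowski b b * E a b * X a b)"
  shows "- minkowski a b * (h - 1 / 2 * HB) + 1 / 2 * minkowski 0 a * minkowski 0 b * HB
      - (\<Sum>c\<in>UNIV. minkowski c c * E a c * X b c)
      - (minkowski 0 a * (minkowski b b * p_comp X b) + minkowski 0 b * (minkowski a a * p_comp X a))
    = (s * hs + p * hp - h) * minkowski a b + (FF a b + FF b a) / 8"
proof -
  have HB: "HB = 4 * (s * hs + p * hp)"
    unfolding HB_def by (rule contraction_HB)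
  have W: "(\<Sum>c\<in>UNIV. minkowski c c * E a c * X b c) = W a b"
    unfolding W_def by (intro sum.cong refl) (simp add: minkowski_def E_0)
  have spatial: "a = 0 \<or> a \<in> {1, 2, 3, 4, 5}" for a :: 6
    using UNIV_6 by blast
  have W0: "W 0 x = 0" "W x 0 = 0" for x
    by (simp_all add: W_def E_0 X_0)
  have m: "minkowski 0 x = 0" "minkowski x 0 = 0" "minkowski x x = 1" if "x \<in> {1, 2, 3, 4, 5}" for x
    using that by (auto simp: minkowski_def)
  have m0: "minkowski 0 0 = -1" by (simp add: minkowski_def)
  have msym: "minkowski a b = minkowski b a" by (simp add: minkowski_def)
  consider "a = 0" "b = 0" | "a = 0" "b \<in> {1, 2, 3, 4, 5}" | "a \<in> {1, 2, 3, 4, 5}" "b = 0"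
    | "a \<in> {1, 2, 3, 4, 5}" "b \<in> {1, 2, 3, 4, 5}"
    using spatial[of a] spatial[of b] by blast
  then show ?thesis
  proof cases
    case 1
    then show ?thesis
      unfolding HB W by (simp add: m0 W0 FF_time_time p_comp_0 field_simps)
  next
    case 2
    then show ?thesis
      unfolding HB W using FF_time_space[of b] by (simp add: m m0 W0 p_comp_0)
  next
    case 3
    then show ?thesis
      unfolding HB W using FF_time_space[of a] by (simp add: m m0 W0 p_comp_0)
  next
    case 4
    show ?thesis
      unfolding HB W FF_space_space[OF 4] FF_space_space[OF 4(2,1)] W_commute[of b a] msym[symmetric]
      using m[OF 4(1)] m[OF 4(2)] by (simp add: field_simps)
  qed
qed

end

section \<open>Frame components of tensors\<close>

lemma sum_swap_3_1:
  "(\<Sum>i\<in>A. \<Sum>j\<in>B. \<Sum>k\<in>C. \<Sum>l\<in>D. f i j k l) = (\<Sum>l\<in>D. \<Sum>i\<in>A. \<Sum>j\<in>B. \<Sum>k\<in>C. f i j k l)"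
  for f :: "_ \<Rightarrow> _ \<Rightarrow> _ \<Rightarrow> _ \<Rightarrow> 'a :: comm_monoid_add"
proof -
  have "(\<Sum>i\<in>A. \<Sum>j\<in>B. \<Sum>k\<in>C. \<Sum>l\<in>D. f i j k l) = (\<Sum>i\<in>A. \<Sum>l\<in>D. \<Sum>j\<in>B. \<Sum>k\<in>C. f i j k l)"
    by (intro sum.cong refl sum_swap_2_1)
  also have "\<dots> = (\<Sum>l\<in>D. \<Sum>i\<in>A. \<Sum>j\<in>B. \<Sum>k\<in>C. f i j k l)"
    by (rule sum.swap)
  finally show ?thesis .
qed

text \<open>The pattern behind every change of basis below: pairing a slot of a frame expansion with
  a vector moves the pairing onto the frame vectors and leaves the coefficients alone.\<close>

lemma sum_contract_1:
  "(\<Sum>\<alpha>\<in>A. u \<alpha> * (\<Sum>a\<in>B. T a * x a \<alpha>)) = (\<Sum>a\<in>B. T a * (\<Sum>\<alpha>\<in>A. u \<alpha> * x a \<alpha>))"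
  for u :: "_ \<Rightarrow> real"
  unfolding sum_distrib_left by (subst sum.swap) (intro sum.cong refl, simp)

lemma sum_contract_2:
  "(\<Sum>\<alpha>\<in>A. \<Sum>\<beta>\<in>A. u \<alpha> * w \<beta> * (\<Sum>a\<in>B. \<Sum>b\<in>B. T a b * x a \<alpha> * y b \<beta>))
   = (\<Sum>a\<in>B. \<Sum>b\<in>B. T a b * (\<Sum>\<alpha>\<in>A. u \<alpha> * x a \<alpha>) * (\<Sum>\<beta>\<in>A. w \<beta> * y b \<beta>))"
  for u :: "_ \<Rightarrow> real"
proof -
  have "(\<Sum>\<beta>\<in>A. u \<alpha> * w \<beta> * (\<Sum>a\<in>B. \<Sum>b\<in>B. T a b * x a \<alpha> * y b \<beta>))
    = u \<alpha> * (\<Sum>a\<in>B. (\<Sum>b\<in>B. T a b * (\<Sum>\<beta>\<in>A. w \<beta> * y b \<beta>)) * x a \<alpha>)" for \<alpha>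
  proof -
    have "(\<Sum>\<beta>\<in>A. u \<alpha> * w \<beta> * (\<Sum>a\<in>B. \<Sum>b\<in>B. T a b * x a \<alpha> * y b \<beta>))
      = u \<alpha> * (\<Sum>\<beta>\<in>A. w \<beta> * (\<Sum>a\<in>B. x a \<alpha> * (\<Sum>b\<in>B. T a b * y b \<beta>)))"
      by (simp add: sum_distrib_left mult_ac)
    also have "(\<Sum>\<beta>\<in>A. w \<beta> * (\<Sum>a\<in>B. x a \<alpha> * (\<Sum>b\<in>B. T a b * y b \<beta>)))
      = (\<Sum>a\<in>B. x a \<alpha> * (\<Sum>\<beta>\<in>A. w \<beta> * (\<Sum>b\<in>B. T a b * y b \<beta>)))"
      by (rule sum_contract_1)
    also have "\<dots> = (\<Sum>a\<in>B. (\<Sum>b\<in>B. T a b * (\<Sum>\<beta>\<in>A. w \<beta> * y b \<beta>)) * x a \<alpha>)"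
      by (intro sum.cong refl) (subst sum_contract_1, rule mult.commute)
    finally show ?thesis .
  qed
  then have "(\<Sum>\<alpha>\<in>A. \<Sum>\<beta>\<in>A. u \<alpha> * w \<beta> * (\<Sum>a\<in>B. \<Sum>b\<in>B. T a b * x a \<alpha> * y b \<beta>))
    = (\<Sum>\<alpha>\<in>A. u \<alpha> * (\<Sum>a\<in>B. (\<Sum>b\<in>B. T a b * (\<Sum>\<beta>\<in>A. w \<beta> * y b \<beta>)) * x a \<alpha>))"
    by (intro sum.cong refl)
  also have "\<dots> = (\<Sum>a\<in>B. (\<Sum>b\<in>B. T a b * (\<Sum>\<beta>\<in>A. w \<beta> * y b \<beta>)) * (\<Sum>\<alpha>\<in>A. u \<alpha> * x a \<alpha>))"
    by (rule sum_contract_1)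
  also have "\<dots> = (\<Sum>a\<in>B. \<Sum>b\<in>B. T a b * (\<Sum>\<alpha>\<in>A. u \<alpha> * x a \<alpha>) * (\<Sum>\<beta>\<in>A. w \<beta> * y b \<beta>))"
    by (intro sum.cong refl, subst sum_distrib_right) (intro sum.cong refl, simp)
  finally show ?thesis .
qed

lemma sum_contract_3:
  "(\<Sum>\<alpha>\<in>A. \<Sum>\<beta>\<in>A. \<Sum>\<gamma>\<in>A. u \<alpha> * w \<beta> * v \<gamma> * (\<Sum>a\<in>B. \<Sum>b\<in>B. \<Sum>c\<in>B. T a b c * x a \<alpha> * y b \<beta> * z c \<gamma>))
   = (\<Sum>a\<in>B. \<Sum>b\<in>B. \<Sum>c\<in>B. T a b c * (\<Sum>\<alpha>\<in>A. u \<alpha> * x a \<alpha>) * (\<Sum>\<beta>\<in>A. w \<beta> * y b \<beta>)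
        * (\<Sum>\<gamma>\<in>A. v \<gamma> * z c \<gamma>))"
  for u :: "_ \<Rightarrow> real"
proof -
  let ?I = "\<lambda>a. \<Sum>b\<in>B. \<Sum>c\<in>B. T a b c * (\<Sum>\<beta>\<in>A. w \<beta> * y b \<beta>) * (\<Sum>\<gamma>\<in>A. v \<gamma> * z c \<gamma>)"
  have "(\<Sum>\<beta>\<in>A. \<Sum>\<gamma>\<in>A. u \<alpha> * w \<beta> * v \<gamma> * (\<Sum>a\<in>B. \<Sum>b\<in>B. \<Sum>c\<in>B. T a b c * x a \<alpha> * y b \<beta> * z c \<gamma>))
    = u \<alpha> * (\<Sum>a\<in>B. ?I a * x a \<alpha>)" for \<alpha>
  proof -
    have "(\<Sum>\<beta>\<in>A. \<Sum>\<gamma>\<in>A. u \<alpha> * w \<beta> * v \<gamma> * (\<Sum>a\<in>B. \<Sum>b\<in>B. \<Sum>c\<in>B. T a b c * x a \<alpha> * y b \<beta> * z c \<gamma>))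
      = u \<alpha> * (\<Sum>\<beta>\<in>A. \<Sum>\<gamma>\<in>A. \<Sum>a\<in>B. x a \<alpha> * (w \<beta> * v \<gamma> * (\<Sum>b\<in>B. \<Sum>c\<in>B. T a b c * y b \<beta> * z c \<gamma>)))"
      by (simp add: sum_distrib_left mult_ac)
    also have "(\<Sum>\<beta>\<in>A. \<Sum>\<gamma>\<in>A. \<Sum>a\<in>B. x a \<alpha> * (w \<beta> * v \<gamma> * (\<Sum>b\<in>B. \<Sum>c\<in>B. T a b c * y b \<beta> * z c \<gamma>)))
      = (\<Sum>a\<in>B. \<Sum>\<beta>\<in>A. \<Sum>\<gamma>\<in>A. x a \<alpha> * (w \<beta> * v \<gamma> * (\<Sum>b\<in>B. \<Sum>c\<in>B. T a b c * y b \<beta> * z c \<gamma>)))"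
      by (rule sum_swap_2_1)
    also have "\<dots> = (\<Sum>a\<in>B. x a \<alpha> * (\<Sum>\<beta>\<in>A. \<Sum>\<gamma>\<in>A. w \<beta> * v \<gamma> * (\<Sum>b\<in>B. \<Sum>c\<in>B. T a b c * y b \<beta> * z c \<gamma>)))"
      by (simp only: sum_distrib_left)
    also have "\<dots> = (\<Sum>a\<in>B. ?I a * x a \<alpha>)"
      by (intro sum.cong refl) (subst sum_contract_2, rule mult.commute)
    finally show ?thesis .
  qed
  then have "(\<Sum>\<alpha>\<in>A. \<Sum>\<beta>\<in>A. \<Sum>\<gamma>\<in>A. u \<alpha> * w \<beta> * v \<gamma> * (\<Sum>a\<in>B. \<Sum>b\<in>B. \<Sum>c\<in>B. T a b c * x a \<alpha> * y b \<beta> * z c \<gamma>))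
    = (\<Sum>\<alpha>\<in>A. u \<alpha> * (\<Sum>a\<in>B. ?I a * x a \<alpha>))"
    by (intro sum.cong refl)
  also have "\<dots> = (\<Sum>a\<in>B. ?I a * (\<Sum>\<alpha>\<in>A. u \<alpha> * x a \<alpha>))"
    by (rule sum_contract_1)
  also have "\<dots> = (\<Sum>a\<in>B. \<Sum>b\<in>B. \<Sum>c\<in>B. T a b c * (\<Sum>\<alpha>\<in>A. u \<alpha> * x a \<alpha>) * (\<Sum>\<beta>\<in>A. w \<beta> * y b \<beta>)
        * (\<Sum>\<gamma>\<in>A. v \<gamma> * z c \<gamma>))"
    unfolding sum_distrib_right by (intro sum.cong refl) (simp only: mult_ac)
  finally show ?thesis .
qed

lemma sum_minkowski: "(\<Sum>a\<in>UNIV. f a * minkowski b a) = f b * minkowski b b"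
proof -
  have "(\<Sum>a\<in>UNIV. f a * minkowski b a) = (\<Sum>a\<in>UNIV. if a = b then f b * minkowski b b else 0)"
    by (rule sum.cong) (simp_all add: minkowski_def)
  then show ?thesis by simp
qed

lemma sum_of_bool_eq: "(\<Sum>a\<in>UNIV. f a * of_bool (a = b)) = f b" for f :: "'a::finite \<Rightarrow> real"
proof -
  have "(\<Sum>a\<in>UNIV. f a * of_bool (a = b)) = (\<Sum>a\<in>UNIV. if a = b then f b else 0)"
    by (rule sum.cong) simp_all
  then show ?thesis by simp
qed

lemma minkowski_commute: "minkowski a b = minkowski b a"
  by (simp add: minkowski_def)

lemma minkowski_sq: "minkowski a a * minkowski a a = 1"
  by (simp add: minkowski_def)

locale lorentz_frame =
  fixes g :: "real^6^6" and e :: "6 \<Rightarrow> real^6"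
  assumes g_sym: "transpose g = g"
    and frame: "orthonormal_frame g e"
begin

abbreviation eta :: "6 \<Rightarrow> real" where "eta a \<equiv> minkowski a a"

lemma g_commute: "g $ \<mu> $ \<nu> = g $ \<nu> $ \<mu>"
  using g_sym unfolding transpose_eq_self_iff by blast

lemma frame_dual: "(\<Sum>\<mu>\<in>UNIV. e a $ \<mu> * lower g (e b) $ \<mu>) = minkowski a b"
  using frame by (simp add: orthonormal_frame_ip ip_lower)

text \<open>Orthonormality says that the matrix of lowered frame vectors, weighted by
  \<open>eta\<close>, is a right inverse of the frame matrix. For square matrices it is then a left
  inverse, which is completeness.\<close>

lemma frame_complete: "(\<Sum>a\<in>UNIV. eta a * e a $ \<mu> * lower g (e a) $ \<nu>) = of_bool (\<mu> = \<nu>)"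
proof -
  define M where "M = (\<chi> a \<mu>. e a $ \<mu>)"
  define W where "W = (\<chi> \<mu> a. eta a * lower g (e a) $ \<mu>)"
  have "(M ** W) $ a $ b = mat 1 $ a $ b" for a b
  proof -
    have "(M ** W) $ a $ b = eta b * (\<Sum>\<mu>\<in>UNIV. e a $ \<mu> * lower g (e b) $ \<mu>)"
      by (simp add: M_def W_def matrix_matrix_mult_def sum_distrib_left mult.left_commute)
    also have "\<dots> = mat 1 $ a $ b"
      unfolding frame_dual by (simp add: minkowski_def mat_def)
    finally show ?thesis .
  qed
  then have "M ** W = mat 1" by (simp add: vec_eq_iff)
  then have "W ** M = mat 1" using matrix_left_right_inverse by blast
  then have "(W ** M) $ \<nu> $ \<mu> = (mat 1 :: real^6^6) $ \<nu> $ \<mu>" by simp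
  then show ?thesis
    by (simp add: M_def W_def matrix_matrix_mult_def mat_def mult_ac of_bool_def eq_commute)
qed

lemma matrix_inv_g: "matrix_inv g $ \<mu> $ \<nu> = (\<Sum>a\<in>UNIV. eta a * e a $ \<mu> * e a $ \<nu>)"
proof -
  define G :: "real^6^6" where "G = (\<chi> \<mu> \<nu>. \<Sum>a\<in>UNIV. eta a * e a $ \<mu> * e a $ \<nu>)"
  have "(G ** g) $ \<mu> $ \<nu> = mat 1 $ \<mu> $ \<nu>" for \<mu> \<nu>
  proof -
    have "(G ** g) $ \<mu> $ \<nu> = (\<Sum>a\<in>UNIV. eta a * e a $ \<mu> * lower g (e a) $ \<nu>)"
      unfolding G_def matrix_matrix_mult_def lower_def
      by (simp add: sum_distrib_right sum_distrib_left g_commute[of \<nu>], subst sum.swap, simp add: mult_ac)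
    then show ?thesis unfolding frame_complete by (simp add: mat_def)
  qed
  then have Gg: "G ** g = mat 1" by (simp add: vec_eq_iff)
  then have gG: "g ** G = mat 1" using matrix_left_right_inverse by blast
  \<comment> \<open>\<open>matrix_inv\<close> is defined by choice; \<open>G\<close> is the witness
    that there is a two-sided inverse to choose.\<close>
  have "g ** matrix_inv g = mat 1 \<and> matrix_inv g ** g = mat 1"
    unfolding matrix_inv_def by (rule someI[of _ G]) (simp add: Gg gG)
  then have "matrix_inv g = G"
    by (metis Gg matrix_mul_assoc matrix_mul_lid matrix_mul_rid)
  then show ?thesis by (simp add: G_def)
qed

section \<open>Covariant components of tensors in the frame\<close>

definition comp2 :: "real^6^6 \<Rightarrow> 6 \<Rightarrow> 6 \<Rightarrow> real" where
  "comp2 X a b = (\<Sum>\<mu>\<in>UNIV. \<Sum>\<nu>\<in>UNIV. e a $ \<mu> * e b $ \<nu> * X $ \<mu> $ \<nu>)"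

definition comp3 :: "real^6^6^6 \<Rightarrow> 6 \<Rightarrow> 6 \<Rightarrow> 6 \<Rightarrow> real" where
  "comp3 F a b c = (\<Sum>\<mu>\<in>UNIV. \<Sum>\<nu>\<in>UNIV. \<Sum>\<rho>\<in>UNIV. e a $ \<mu> * e b $ \<nu> * e c $ \<rho> * F $ \<mu> $ \<nu> $ \<rho>)"

lemma comp2_iterated: "comp2 X a b = (\<Sum>\<mu>\<in>UNIV. e a $ \<mu> * (\<Sum>\<nu>\<in>UNIV. e b $ \<nu> * X $ \<mu> $ \<nu>))"
  unfolding comp2_def by (simp only: sum_distrib_left mult.assoc)

lemma comp2_linear:
  "comp2 (X + Y) a b = comp2 X a b + comp2 Y a b"
  "comp2 (X - Y) a b = comp2 X a b - comp2 Y a b"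
  "comp2 (t *\<^sub>R X) a b = t * comp2 X a b"
  unfolding comp2_def
  by (simp_all add: sum.distrib sum_subtractf sum_distrib_left distrib_left right_diff_distrib mult.left_commute)

lemma comp2_expand:
  "X $ \<mu> $ \<nu> = (\<Sum>a\<in>UNIV. \<Sum>b\<in>UNIV. comp2 X a b * (eta a * lower g (e a) $ \<mu>) * (eta b * lower g (e b) $ \<nu>))"
proof -
  have "(\<Sum>a\<in>UNIV. \<Sum>b\<in>UNIV. (eta a * lower g (e a) $ \<mu>) * (eta b * lower g (e b) $ \<nu>) *
      (\<Sum>\<alpha>\<in>UNIV. \<Sum>\<beta>\<in>UNIV. X $ \<alpha> $ \<beta> * e a $ \<alpha> * e b $ \<beta>))
    = (\<Sum>\<alpha>\<in>UNIV. \<Sum>\<beta>\<in>UNIV. X $ \<alpha> $ \<beta> * (\<Sum>a\<in>UNIV. (eta a * lower g (e a) $ \<mu>) * e a $ \<alpha>)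
        * (\<Sum>b\<in>UNIV. (eta b * lower g (e b) $ \<nu>) * e b $ \<beta>))"
    by (rule sum_contract_2)
  also have "\<dots> = (\<Sum>\<alpha>\<in>UNIV. \<Sum>\<beta>\<in>UNIV. X $ \<alpha> $ \<beta> * of_bool (\<alpha> = \<mu>) * of_bool (\<beta> = \<nu>))"
    unfolding frame_complete[symmetric] by (simp only: mult_ac)
  also have "\<dots> = X $ \<mu> $ \<nu>"
    by (simp only: sum_of_bool_eq)
  finally show ?thesis
    unfolding comp2_def by (simp only: mult_ac)
qed

lemma comp2_eqI:
  assumes "\<And>a b. comp2 X a b = comp2 Y a b"
  shows "X = Y"
  unfolding vec_eq_iff by (subst (1 2) comp2_expand) (simp add: assms)

lemma raise2_expand:
  "raise2 g Y $ \<mu> $ \<nu> = (\<Sum>a\<in>UNIV. \<Sum>b\<in>UNIV. eta a * eta b * comp2 Y a b * e a $ \<mu> * e b $ \<nu>)"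
proof -
  have "raise2 g Y $ \<mu> $ \<nu> = (\<Sum>\<alpha>\<in>UNIV. \<Sum>\<beta>\<in>UNIV. Y $ \<alpha> $ \<beta> *
      (\<Sum>a\<in>UNIV. (eta a * e a $ \<mu>) * e a $ \<alpha>) * (\<Sum>b\<in>UNIV. (eta b * e b $ \<nu>) * e b $ \<beta>))"
    unfolding raise2_def lower2_def matrix_inv_g by (simp add: mult_ac)
  also have "\<dots> = (\<Sum>a\<in>UNIV. \<Sum>b\<in>UNIV. (eta a * e a $ \<mu>) * (eta b * e b $ \<nu>) *
      (\<Sum>\<alpha>\<in>UNIV. \<Sum>\<beta>\<in>UNIV. Y $ \<alpha> $ \<beta> * e a $ \<alpha> * e b $ \<beta>))"
    by (rule sum_contract_2[symmetric])
  finally show ?thesis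
    unfolding comp2_def by (simp only: mult_ac)
qed

lemma contract2_components:
  "contract2 g X Y = (\<Sum>a\<in>UNIV. \<Sum>b\<in>UNIV. eta a * eta b * comp2 X a b * comp2 Y a b)"
proof -
  have "contract2 g X Y = (\<Sum>\<mu>\<in>UNIV. \<Sum>\<nu>\<in>UNIV. \<Sum>a\<in>UNIV. \<Sum>b\<in>UNIV.
      eta a * eta b * comp2 Y a b * (e a $ \<mu> * e b $ \<nu> * X $ \<mu> $ \<nu>))"
    unfolding contract2_def raise2_expand sum_distrib_left by (simp only: mult_ac)
  also have "\<dots> = (\<Sum>a\<in>UNIV. \<Sum>b\<in>UNIV. \<Sum>\<mu>\<in>UNIV. \<Sum>\<nu>\<in>UNIV.
      eta a * eta b * comp2 Y a b * (e a $ \<mu> * e b $ \<nu> * X $ \<mu> $ \<nu>))"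
    by (rule sum_swap_2_2)
  also have "\<dots> = (\<Sum>a\<in>UNIV. \<Sum>b\<in>UNIV. eta a * eta b * comp2 Y a b * comp2 X a b)"
    unfolding comp2_def[of X] by (simp only: sum_distrib_left)
  finally show ?thesis by (simp only: mult_ac)
qed

lemma comp2_contraction:
  "comp2 (\<chi> \<mu> \<nu>. \<Sum>\<sigma>\<in>UNIV. \<Sum>\<rho>\<in>UNIV. X $ \<mu> $ \<sigma> * matrix_inv g $ \<sigma> $ \<rho> * Y $ \<nu> $ \<rho>) a b
   = (\<Sum>c\<in>UNIV. eta c * comp2 X a c * comp2 Y b c)"
proof -
  have XY: "(\<Sum>\<sigma>\<in>UNIV. \<Sum>\<rho>\<in>UNIV. X $ \<mu> $ \<sigma> * matrix_inv g $ \<sigma> $ \<rho> * Y $ \<nu> $ \<rho>)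
    = (\<Sum>c\<in>UNIV. eta c * ((\<Sum>\<sigma>\<in>UNIV. e c $ \<sigma> * X $ \<mu> $ \<sigma>) * (\<Sum>\<rho>\<in>UNIV. e c $ \<rho> * Y $ \<nu> $ \<rho>)))" for \<mu> \<nu>
  proof -
    have "(\<Sum>\<sigma>\<in>UNIV. \<Sum>\<rho>\<in>UNIV. X $ \<mu> $ \<sigma> * matrix_inv g $ \<sigma> $ \<rho> * Y $ \<nu> $ \<rho>)
      = (\<Sum>\<sigma>\<in>UNIV. \<Sum>\<rho>\<in>UNIV. \<Sum>c\<in>UNIV. eta c * ((e c $ \<sigma> * X $ \<mu> $ \<sigma>) * (e c $ \<rho> * Y $ \<nu> $ \<rho>)))"
      unfolding matrix_inv_g sum_distrib_left sum_distrib_right by (simp only: mult_ac)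
    also have "\<dots> = (\<Sum>c\<in>UNIV. \<Sum>\<sigma>\<in>UNIV. \<Sum>\<rho>\<in>UNIV. eta c * ((e c $ \<sigma> * X $ \<mu> $ \<sigma>) * (e c $ \<rho> * Y $ \<nu> $ \<rho>)))"
      by (rule sum_swap_2_1)
    finally show ?thesis
      by (simp only: sum_product) (simp only: sum_distrib_left)
  qed
  have "comp2 (\<chi> \<mu> \<nu>. \<Sum>\<sigma>\<in>UNIV. \<Sum>\<rho>\<in>UNIV. X $ \<mu> $ \<sigma> * matrix_inv g $ \<sigma> $ \<rho> * Y $ \<nu> $ \<rho>) a b
    = (\<Sum>\<mu>\<in>UNIV. \<Sum>\<nu>\<in>UNIV. \<Sum>c\<in>UNIV. eta c * ((e a $ \<mu> * (\<Sum>\<sigma>\<in>UNIV. e c $ \<sigma> * X $ \<mu> $ \<sigma>))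
        * (e b $ \<nu> * (\<Sum>\<rho>\<in>UNIV. e c $ \<rho> * Y $ \<nu> $ \<rho>))))"
  proof -
    have "e a $ \<mu> * e b $ \<nu> * (\<Sum>c\<in>UNIV. eta c * (f \<mu> c * h \<nu> c))
      = (\<Sum>c\<in>UNIV. eta c * ((e a $ \<mu> * f \<mu> c) * (e b $ \<nu> * h \<nu> c)))" for \<mu> \<nu> and f h :: "6 \<Rightarrow> 6 \<Rightarrow> real"
      unfolding sum_distrib_left by (simp only: mult_ac)
    then show ?thesis
      unfolding comp2_def vec_lambda_beta XY by (intro sum.cong refl)
  qed
  also have "\<dots> = (\<Sum>c\<in>UNIV. \<Sum>\<mu>\<in>UNIV. \<Sum>\<nu>\<in>UNIV. eta c * ((e a $ \<mu> * (\<Sum>\<sigma>\<in>UNIV. e c $ \<sigma> * X $ \<mu> $ \<sigma>))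
        * (e b $ \<nu> * (\<Sum>\<rho>\<in>UNIV. e c $ \<rho> * Y $ \<nu> $ \<rho>))))"
    by (rule sum_swap_2_1)
  also have "\<dots> = (\<Sum>c\<in>UNIV. eta c * ((\<Sum>\<mu>\<in>UNIV. e a $ \<mu> * (\<Sum>\<sigma>\<in>UNIV. e c $ \<sigma> * X $ \<mu> $ \<sigma>))
        * (\<Sum>\<nu>\<in>UNIV. e b $ \<nu> * (\<Sum>\<rho>\<in>UNIV. e c $ \<rho> * Y $ \<nu> $ \<rho>))))"
    by (simp only: sum_product) (simp only: sum_distrib_left)
  also have "\<dots> = (\<Sum>c\<in>UNIV. eta c * comp2 X a c * comp2 Y b c)"
    unfolding comp2_iterated by (simp only: mult.assoc)
  finally show ?thesis .
qed

end

section \<open>Frame expansions of the dual, of p and of s\<close>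

lemma sum_product_1_2_2:
  "(\<Sum>i\<in>A. \<Sum>j\<in>A. \<Sum>k\<in>A. \<Sum>l\<in>A. \<Sum>m\<in>A. K * f i * h j k * h' l m)
    = K * (\<Sum>i\<in>A. f i) * (\<Sum>j\<in>A. \<Sum>k\<in>A. h j k) * (\<Sum>l\<in>A. \<Sum>m\<in>A. h' l m)" for K :: real
  by (simp only: sum_distrib_left[symmetric] sum_distrib_right[symmetric])

context lorentz_frame begin

text \<open>Each term of the Levi-Civita tensor is a product of six frame vectors. Three of them are
  contracted with F and turn it into frame components; the other three carry the free
  indices.\<close>

lemma dual3_up_expand:
  "dual3_up e F $ \<mu> $ \<nu> $ \<rho> = (\<Sum>a\<in>UNIV. \<Sum>b\<in>UNIV. \<Sum>c\<in>UNIV.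
     dual_comp (comp3 F) a b c * e a $ \<mu> * e b $ \<nu> * e c $ \<rho>)"
proof -
  let ?S = "\<Sum>\<pi> | \<pi> permutes (UNIV :: 6 set). of_int (sign \<pi>) * comp3 F (\<pi> 3) (\<pi> 4) (\<pi> 5) *
      (e (\<pi> 0) $ \<mu> * e (\<pi> 1) $ \<nu> * e (\<pi> 2) $ \<rho>)"
  have "(\<Sum>\<alpha>\<in>UNIV. \<Sum>\<beta>\<in>UNIV. \<Sum>\<gamma>\<in>UNIV. levi_civita e \<mu> \<nu> \<rho> \<alpha> \<beta> \<gamma> * F $ \<alpha> $ \<beta> $ \<gamma>)
    = (\<Sum>\<alpha>\<in>UNIV. \<Sum>\<beta>\<in>UNIV. \<Sum>\<gamma>\<in>UNIV. \<Sum>\<pi> | \<pi> permutes (UNIV :: 6 set).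
       (- of_int (sign \<pi>) * (e (\<pi> 0) $ \<mu> * e (\<pi> 1) $ \<nu> * e (\<pi> 2) $ \<rho>)) *
        (e (\<pi> 3) $ \<alpha> * e (\<pi> 4) $ \<beta> * e (\<pi> 5) $ \<gamma> * F $ \<alpha> $ \<beta> $ \<gamma>))"
    unfolding levi_civita_def sum_distrib_right by (simp only: mult_ac)
  also have "\<dots> = (\<Sum>\<pi> | \<pi> permutes (UNIV :: 6 set). \<Sum>\<alpha>\<in>UNIV. \<Sum>\<beta>\<in>UNIV. \<Sum>\<gamma>\<in>UNIV.
       (- of_int (sign \<pi>) * (e (\<pi> 0) $ \<mu> * e (\<pi> 1) $ \<nu> * e (\<pi> 2) $ \<rho>)) *
        (e (\<pi> 3) $ \<alpha> * e (\<pi> 4) $ \<beta> * e (\<pi> 5) $ \<gamma> * F $ \<alpha> $ \<beta> $ \<gamma>))"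
    by (rule sum_swap_3_1)
  also have "\<dots> = (\<Sum>\<pi> | \<pi> permutes (UNIV :: 6 set).
       (- of_int (sign \<pi>) * (e (\<pi> 0) $ \<mu> * e (\<pi> 1) $ \<nu> * e (\<pi> 2) $ \<rho>)) * comp3 F (\<pi> 3) (\<pi> 4) (\<pi> 5))"
    unfolding comp3_def by (simp only: sum_distrib_left)
  also have "\<dots> = - ?S"
    unfolding sum_negf[symmetric] by (intro sum.cong refl) simp
  finally have lhs: "dual3_up e F $ \<mu> $ \<nu> $ \<rho> = - 1 / 6 * ?S"
    by (simp add: dual3_up_def fact_numeral)
  have delta: "(\<Sum>a\<in>UNIV. \<Sum>b\<in>UNIV. \<Sum>c\<in>UNIV.
       (if \<pi> 0 = a \<and> \<pi> 1 = b \<and> \<pi> 2 = c then r else 0) * (e a $ \<mu> * e b $ \<nu> * e c $ \<rho>))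
     = r * (e (\<pi> 0) $ \<mu> * e (\<pi> 1) $ \<nu> * e (\<pi> 2) $ \<rho>)" for \<pi> :: "6 \<Rightarrow> 6" and r :: real
  proof -
    have "(\<Sum>a\<in>UNIV. \<Sum>b\<in>UNIV. \<Sum>c\<in>UNIV.
       (if \<pi> 0 = a \<and> \<pi> 1 = b \<and> \<pi> 2 = c then r else 0) * (e a $ \<mu> * e b $ \<nu> * e c $ \<rho>))
      = (\<Sum>a\<in>UNIV. \<Sum>b\<in>UNIV. \<Sum>c\<in>UNIV. r * (e a $ \<mu> * e b $ \<nu> * e c $ \<rho>) *
          of_bool (a = \<pi> 0) * of_bool (b = \<pi> 1) * of_bool (c = \<pi> 2))"
      by (intro sum.cong refl) auto
    also have "\<dots> = r * (e (\<pi> 0) $ \<mu> * e (\<pi> 1) $ \<nu> * e (\<pi> 2) $ \<rho>)"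
      by (simp only: sum_of_bool_eq)
    finally show ?thesis .
  qed
  have "(\<Sum>a\<in>UNIV. \<Sum>b\<in>UNIV. \<Sum>c\<in>UNIV. dual_comp (comp3 F) a b c * e a $ \<mu> * e b $ \<nu> * e c $ \<rho>)
    = (\<Sum>a\<in>UNIV. \<Sum>b\<in>UNIV. \<Sum>c\<in>UNIV. \<Sum>\<pi> | \<pi> permutes (UNIV :: 6 set). (- 1 / 6 * of_int (sign \<pi>)) *
      ((if \<pi> 0 = a \<and> \<pi> 1 = b \<and> \<pi> 2 = c then comp3 F (\<pi> 3) (\<pi> 4) (\<pi> 5) else 0) * (e a $ \<mu> * e b $ \<nu> * e c $ \<rho>)))"
    unfolding dual_comp_def sum_distrib_left sum_distrib_right by (simp only: mult_ac)
  also have "\<dots> = (\<Sum>\<pi> | \<pi> permutes (UNIV :: 6 set). \<Sum>a\<in>UNIV. \<Sum>b\<in>UNIV. \<Sum>c\<in>UNIV. (- 1 / 6 * of_int (sign \<pi>)) *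
      ((if \<pi> 0 = a \<and> \<pi> 1 = b \<and> \<pi> 2 = c then comp3 F (\<pi> 3) (\<pi> 4) (\<pi> 5) else 0) * (e a $ \<mu> * e b $ \<nu> * e c $ \<rho>)))"
    by (rule sum_swap_3_1)
  also have "\<dots> = - 1 / 6 * ?S"
    unfolding sum_distrib_left[symmetric] delta by (simp add: sum_distrib_left mult.assoc)
  finally show ?thesis
    unfolding lhs by (rule sym)
qed

lemma comp3_lower3:
  assumes "\<And>\<mu> \<nu> \<rho>. U $ \<mu> $ \<nu> $ \<rho> = (\<Sum>a\<in>UNIV. \<Sum>b\<in>UNIV. \<Sum>c\<in>UNIV. T a b c * e a $ \<mu> * e b $ \<nu> * e c $ \<rho>)"
  shows "comp3 (lower3 g U) a b c = eta a * eta b * eta c * T a b c"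
proof -
  have "lower3 g U $ \<mu> $ \<nu> $ \<rho> = (\<Sum>a\<in>UNIV. \<Sum>b\<in>UNIV. \<Sum>c\<in>UNIV.
      T a b c * lower g (e a) $ \<mu> * lower g (e b) $ \<nu> * lower g (e c) $ \<rho>)" for \<mu> \<nu> \<rho>
    unfolding lower3_def lower_def vec_lambda_beta assms by (rule sum_contract_3)
  then have "comp3 (lower3 g U) a b c = (\<Sum>\<mu>\<in>UNIV. \<Sum>\<nu>\<in>UNIV. \<Sum>\<rho>\<in>UNIV. e a $ \<mu> * e b $ \<nu> * e c $ \<rho> *
     (\<Sum>a\<in>UNIV. \<Sum>b\<in>UNIV. \<Sum>c\<in>UNIV. T a b c * lower g (e a) $ \<mu> * lower g (e b) $ \<nu> * lower g (e c) $ \<rho>))"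
    unfolding comp3_def by (simp only:)
  also have "\<dots> = (\<Sum>a'\<in>UNIV. \<Sum>b'\<in>UNIV. \<Sum>c'\<in>UNIV. T a' b' c' * minkowski a a' * minkowski b b' * minkowski c c')"
    unfolding sum_contract_3 frame_dual ..
  also have "\<dots> = T a b c * eta a * eta b * eta c"
    by (simp only: sum_minkowski sum_distrib_right[symmetric])
  finally show ?thesis by (simp only: mult_ac)
qed

lemma comp3_dual3: "comp3 (dual3 g e F) a b c = eta a * eta b * eta c * dual_comp (comp3 F) a b c"
  unfolding dual3_def by (rule comp3_lower3) (rule dual3_up_expand)

lemma comp2_contract_last: "comp2 (contract_last F (e c)) a b = comp3 F a b c"
  unfolding comp2_def comp3_def contract_last_def vec_lambda_beta sum_distrib_left by (simp only: mult_ac)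

lemma comp2_lower2: "comp2 (lower2 g U) a b = (\<Sum>\<alpha>\<in>UNIV. \<Sum>\<beta>\<in>UNIV. U $ \<alpha> $ \<beta> * lower g (e a) $ \<alpha> * lower g (e b) $ \<beta>)"
proof -
  have lower2: "lower2 g U $ \<mu> $ \<nu> = (\<Sum>\<alpha>\<in>UNIV. \<Sum>\<beta>\<in>UNIV. U $ \<alpha> $ \<beta> * g $ \<alpha> $ \<mu> * g $ \<beta> $ \<nu>)" for \<mu> \<nu>
    unfolding lower2_def vec_lambda_beta
  proof (intro sum.cong refl)
    fix \<alpha> \<beta>
    show "g $ \<mu> $ \<alpha> * g $ \<nu> $ \<beta> * U $ \<alpha> $ \<beta> = U $ \<alpha> $ \<beta> * g $ \<alpha> $ \<mu> * g $ \<beta> $ \<nu>"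
      using g_commute[of \<mu> \<alpha>] g_commute[of \<nu> \<beta>] by simp
  qed
  have "comp2 (lower2 g U) a b = (\<Sum>\<mu>\<in>UNIV. \<Sum>\<nu>\<in>UNIV. e a $ \<mu> * e b $ \<nu> *
      (\<Sum>\<alpha>\<in>UNIV. \<Sum>\<beta>\<in>UNIV. U $ \<alpha> $ \<beta> * g $ \<alpha> $ \<mu> * g $ \<beta> $ \<nu>))"
    unfolding comp2_def lower2 ..
  also have "\<dots> = (\<Sum>\<alpha>\<in>UNIV. \<Sum>\<beta>\<in>UNIV. U $ \<alpha> $ \<beta> * (\<Sum>\<mu>\<in>UNIV. e a $ \<mu> * g $ \<alpha> $ \<mu>) * (\<Sum>\<nu>\<in>UNIV. e b $ \<nu> * g $ \<beta> $ \<nu>))"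
    by (rule sum_contract_2)
  finally show ?thesis
    unfolding lower_def vec_lambda_beta by (simp only: mult.commute)
qed

lemma p_up_expand: "p_up g e (e 0) B $ \<mu> = (\<Sum>a\<in>UNIV. p_comp (comp2 B) a * e a $ \<mu>)"
proof -
  have l0: "(\<Sum>\<nu>\<in>UNIV. e a $ \<nu> * lower g (e 0) $ \<nu>) = - of_bool (a = 0)" for a
    unfolding frame_dual by (simp add: minkowski_def)
  let ?S = "\<Sum>\<pi> | \<pi> permutes (UNIV :: 6 set). of_int (sign \<pi>) * e (\<pi> 0) $ \<mu> * of_bool (\<pi> 1 = 0) *
      comp2 B (\<pi> 2) (\<pi> 3) * comp2 B (\<pi> 4) (\<pi> 5)"
  let ?t = "\<lambda>\<nu> \<rho> \<alpha> \<beta> \<gamma> \<pi>. (- of_int (sign \<pi>) * e (\<pi> 0) $ \<mu>) * (e (\<pi> 1) $ \<nu> * lower g (e 0) $ \<nu>) *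
      (e (\<pi> 2) $ \<rho> * e (\<pi> 3) $ \<alpha> * B $ \<rho> $ \<alpha>) * (e (\<pi> 4) $ \<beta> * e (\<pi> 5) $ \<gamma> * B $ \<beta> $ \<gamma>)"
  have "(\<Sum>\<nu>\<in>UNIV. \<Sum>\<rho>\<in>UNIV. \<Sum>\<alpha>\<in>UNIV. \<Sum>\<beta>\<in>UNIV. \<Sum>\<gamma>\<in>UNIV.
        levi_civita e \<mu> \<nu> \<rho> \<alpha> \<beta> \<gamma> * B $ \<rho> $ \<alpha> * B $ \<beta> $ \<gamma> * lower g (e 0) $ \<nu>)
    = (\<Sum>\<nu>\<in>UNIV. \<Sum>\<rho>\<in>UNIV. \<Sum>\<alpha>\<in>UNIV. \<Sum>\<beta>\<in>UNIV. \<Sum>\<gamma>\<in>UNIV. \<Sum>\<pi> | \<pi> permutes (UNIV :: 6 set). ?t \<nu> \<rho> \<alpha> \<beta> \<gamma> \<pi>)"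
    unfolding levi_civita_def sum_distrib_right by (simp only: mult_ac)
  also have "\<dots> = (\<Sum>\<nu>\<in>UNIV. \<Sum>\<rho>\<in>UNIV. \<Sum>\<pi> | \<pi> permutes (UNIV :: 6 set). \<Sum>\<alpha>\<in>UNIV. \<Sum>\<beta>\<in>UNIV. \<Sum>\<gamma>\<in>UNIV. ?t \<nu> \<rho> \<alpha> \<beta> \<gamma> \<pi>)"
    by (intro sum.cong refl sum_swap_3_1)
  also have "\<dots> = (\<Sum>\<pi> | \<pi> permutes (UNIV :: 6 set). \<Sum>\<nu>\<in>UNIV. \<Sum>\<rho>\<in>UNIV. \<Sum>\<alpha>\<in>UNIV. \<Sum>\<beta>\<in>UNIV. \<Sum>\<gamma>\<in>UNIV. ?t \<nu> \<rho> \<alpha> \<beta> \<gamma> \<pi>)"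
    by (rule sum_swap_2_1)
  also have "\<dots> = ?S"
    unfolding sum_product_1_2_2 l0 comp2_def[symmetric] by (intro sum.cong refl) simp
  finally have lhs: "p_up g e (e 0) B $ \<mu> = - 1 / 8 * ?S"
    by (simp add: p_up_def)
  have "(\<Sum>a\<in>UNIV. p_comp (comp2 B) a * e a $ \<mu>)
    = (\<Sum>a\<in>UNIV. \<Sum>\<pi> | \<pi> permutes (UNIV :: 6 set). (- 1 / 8 * of_int (sign \<pi>) *
       (of_bool (\<pi> 1 = 0) * comp2 B (\<pi> 2) (\<pi> 3) * comp2 B (\<pi> 4) (\<pi> 5)) * e a $ \<mu>) * of_bool (a = \<pi> 0))"
    unfolding p_comp_def sum_distrib_left sum_distrib_right by (intro sum.cong refl) auto
  also have "\<dots> = - 1 / 8 * ?S"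
    unfolding sum_distrib_left by (subst sum.swap) (simp only: sum_of_bool_eq, simp only: mult_ac)
  finally show ?thesis
    unfolding lhs by (rule sym)
qed

lemma p_down_expand: "p_down g e (e 0) B $ \<mu> = (\<Sum>a\<in>UNIV. p_comp (comp2 B) a * lower g (e a) $ \<mu>)"
  unfolding p_down_def lower_def vec_lambda_beta p_up_expand by (rule sum_contract_1)

lemma p_down_component:
  "(\<Sum>\<mu>\<in>UNIV. e a $ \<mu> * p_down g e (e 0) B $ \<mu>) = eta a * p_comp (comp2 B) a"
  unfolding p_down_expand sum_contract_1 frame_dual sum_minkowski by (rule mult.commute)

lemma inv_p_components:
  "inv_p g e (e 0) B = sqrt (\<Sum>a\<in>UNIV. eta a * p_comp (comp2 B) a * p_comp (comp2 B) a)"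
proof -
  have "(\<Sum>\<mu>\<in>UNIV. p_down g e (e 0) B $ \<mu> * p_up g e (e 0) B $ \<mu>)
    = (\<Sum>a\<in>UNIV. p_comp (comp2 B) a * (\<Sum>\<mu>\<in>UNIV. p_down g e (e 0) B $ \<mu> * e a $ \<mu>))"
    unfolding p_up_expand by (rule sum_contract_1)
  also have "\<dots> = (\<Sum>a\<in>UNIV. eta a * p_comp (comp2 B) a * p_comp (comp2 B) a)"
    unfolding mult.commute[of "p_down g e (e 0) B $ _"] p_down_component by (simp only: mult_ac)
  finally show ?thesis unfolding inv_p_def by (rule arg_cong)
qed

lemma inv_s_components:
  "inv_s g B = 1 / 4 * (\<Sum>a\<in>UNIV. \<Sum>b\<in>UNIV. eta a * eta b * comp2 B a b * comp2 B a b)"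
  unfolding inv_s_def contract2_components ..

lemma comp2_FF_dual:
  "comp2 (FF_dual g e F) a b
    = (\<Sum>c\<in>UNIV. \<Sum>d\<in>UNIV. comp3 F c d a * (eta b * dual_comp (comp3 F) b c d))"
proof -
  let ?D = "dual_comp (comp3 F)"
  have inner: "(\<Sum>\<nu>\<in>UNIV. e b $ \<nu> * (\<Sum>\<alpha>\<in>UNIV. g $ \<nu> $ \<alpha> * dual3_up e F $ \<alpha> $ \<rho> $ \<tau>))
    = (\<Sum>c\<in>UNIV. \<Sum>d\<in>UNIV. eta b * ?D b c d * e c $ \<rho> * e d $ \<tau>)" for \<rho> \<tau>
  proof -
    have "(\<Sum>\<alpha>\<in>UNIV. g $ \<nu> $ \<alpha> * dual3_up e F $ \<alpha> $ \<rho> $ \<tau>)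
      = (\<Sum>a\<in>UNIV. (\<Sum>c\<in>UNIV. \<Sum>d\<in>UNIV. ?D a c d * e c $ \<rho> * e d $ \<tau>) * lower g (e a) $ \<nu>)" for \<nu>
    proof -
      have "dual3_up e F $ \<alpha> $ \<rho> $ \<tau> = (\<Sum>a\<in>UNIV. (\<Sum>c\<in>UNIV. \<Sum>d\<in>UNIV. ?D a c d * e c $ \<rho> * e d $ \<tau>) * e a $ \<alpha>)" for \<alpha>
        unfolding dual3_up_expand sum_distrib_right by (simp only: mult_ac)
      then show ?thesis unfolding lower_def vec_lambda_beta by (simp only:) (rule sum_contract_1)
    qed
    then have "(\<Sum>\<nu>\<in>UNIV. e b $ \<nu> * (\<Sum>\<alpha>\<in>UNIV. g $ \<nu> $ \<alpha> * dual3_up e F $ \<alpha> $ \<rho> $ \<tau>))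
      = (\<Sum>\<nu>\<in>UNIV. e b $ \<nu> * (\<Sum>a\<in>UNIV. (\<Sum>c\<in>UNIV. \<Sum>d\<in>UNIV. ?D a c d * e c $ \<rho> * e d $ \<tau>) * lower g (e a) $ \<nu>))"
      by (simp only:)
    also have "\<dots> = (\<Sum>a\<in>UNIV. (\<Sum>c\<in>UNIV. \<Sum>d\<in>UNIV. ?D a c d * e c $ \<rho> * e d $ \<tau>) * (\<Sum>\<nu>\<in>UNIV. e b $ \<nu> * lower g (e a) $ \<nu>))"
      by (rule sum_contract_1)
    also have "\<dots> = (\<Sum>c\<in>UNIV. \<Sum>d\<in>UNIV. ?D b c d * e c $ \<rho> * e d $ \<tau>) * eta b"
      unfolding frame_dual by (rule sum_minkowski)
    finally show ?thesis
      unfolding sum_distrib_right by (simp only: mult_ac)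
  qed
  have "comp2 (FF_dual g e F) a b = (\<Sum>\<mu>\<in>UNIV. \<Sum>\<nu>\<in>UNIV. \<Sum>\<rho>\<in>UNIV. \<Sum>\<tau>\<in>UNIV.
     (e a $ \<mu> * F $ \<rho> $ \<tau> $ \<mu>) * (e b $ \<nu> * (\<Sum>\<alpha>\<in>UNIV. g $ \<nu> $ \<alpha> * dual3_up e F $ \<alpha> $ \<rho> $ \<tau>)))"
    unfolding comp2_def FF_dual_def vec_lambda_beta
    unfolding sum_distrib_left[of "e a $ _ * e b $ _"] by (simp only: mult_ac)
  also have "\<dots> = (\<Sum>\<rho>\<in>UNIV. \<Sum>\<tau>\<in>UNIV. \<Sum>\<mu>\<in>UNIV. \<Sum>\<nu>\<in>UNIV.
     (e a $ \<mu> * F $ \<rho> $ \<tau> $ \<mu>) * (e b $ \<nu> * (\<Sum>\<alpha>\<in>UNIV. g $ \<nu> $ \<alpha> * dual3_up e F $ \<alpha> $ \<rho> $ \<tau>)))"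
    by (rule sum_swap_2_2)
  also have "\<dots> = (\<Sum>\<rho>\<in>UNIV. \<Sum>\<tau>\<in>UNIV. (\<Sum>\<mu>\<in>UNIV. e a $ \<mu> * F $ \<rho> $ \<tau> $ \<mu>) *
      (\<Sum>c\<in>UNIV. \<Sum>d\<in>UNIV. eta b * ?D b c d * e c $ \<rho> * e d $ \<tau>))"
    unfolding sum_product[symmetric] inner ..
  also have "\<dots> = (\<Sum>\<rho>\<in>UNIV. \<Sum>\<tau>\<in>UNIV. \<Sum>c\<in>UNIV. \<Sum>d\<in>UNIV. 
      (eta b * ?D b c d) * (e c $ \<rho> * e d $ \<tau> * (\<Sum>\<mu>\<in>UNIV. e a $ \<mu> * F $ \<rho> $ \<tau> $ \<mu>)))"
    unfolding sum_distrib_left[of "\<Sum>\<mu>\<in>UNIV. e a $ \<mu> * F $ _ $ _ $ \<mu>"] by (simp only: mult_ac)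
  also have "\<dots> = (\<Sum>c\<in>UNIV. \<Sum>d\<in>UNIV. \<Sum>\<rho>\<in>UNIV. \<Sum>\<tau>\<in>UNIV. 
      (eta b * ?D b c d) * (e c $ \<rho> * e d $ \<tau> * (\<Sum>\<mu>\<in>UNIV. e a $ \<mu> * F $ \<rho> $ \<tau> $ \<mu>)))"
    by (rule sum_swap_2_2)
  also have "\<dots> = (\<Sum>c\<in>UNIV. \<Sum>d\<in>UNIV. (eta b * ?D b c d) * comp3 F c d a)"
    unfolding comp3_def sum_distrib_left by (simp only: mult_ac)
  finally show ?thesis by (simp only: mult_ac)
qed

end

section \<open>The derivative of the Hamiltonian\<close>

lemma antisym2_sum:
  assumes "\<And>i. i \<in> A \<Longrightarrow> antisym2 (Y i)"
  shows "antisym2 (\<lambda>a b. \<Sum>i\<in>A. k i * Y i a b)"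
proof -
  have "(\<Sum>i\<in>A. k i * Y i a b) = - (\<Sum>i\<in>A. k i * Y i b a)" for a b
  proof -
    have "Y i a b = - Y i b a" if "i \<in> A" for i
      using assms[OF that] unfolding antisym2_def by blast
    then show ?thesis
      unfolding sum_negf[symmetric] by (intro sum.cong refl) (metis mult_minus_right)
  qed
  then show ?thesis unfolding antisym2_def by blast
qed

lemma p_polar_sum:
  assumes X: "antisym2 X" and "finite A" and "\<And>i. i \<in> A \<Longrightarrow> antisym2 (Y i)"
  shows "p_polar X (\<lambda>a b. \<Sum>i\<in>A. k i * Y i a b) x = (\<Sum>i\<in>A. k i * p_polar X (Y i) x)"
  using assms(2,3)
proof (induction A rule: finite_induct)
  case empty
  have "antisym2 (\<lambda>a b :: 6. 0)" by (simp add: antisym2_def)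
  from p_polar_lincomb[OF X this this, of 0 0 x] show ?case by simp
next
  case (insert i A)
  have "p_polar X (\<lambda>a b. \<Sum>i\<in>insert i A. k i * Y i a b) x
    = p_polar X (\<lambda>a b. k i * Y i a b + 1 * (\<Sum>i\<in>A. k i * Y i a b)) x"
    using insert.hyps by simp
  also have "\<dots> = k i * p_polar X (Y i) x + 1 * p_polar X (\<lambda>a b. \<Sum>i\<in>A. k i * Y i a b) x"
    by (intro p_polar_lincomb X antisym2_sum insert.prems) simp_all
  finally show ?case using insert by simp
qed

text \<open>The auxiliary fact \<open>chain\<close> allows any pair of curves through the given
  point. The two coordinate lines express the partial derivatives through the total derivative, and
  linearity combines them.\<close>

lemma deriv_compose_partials:
  assumes diff: "(\<lambda>(x, y). h x y) differentiable (at (f t, q t))"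
    and f: "(f has_real_derivative f') (at t)" and q: "(q has_real_derivative q') (at t)"
  shows "deriv (\<lambda>t. h (f t) (q t)) t = partial_s h (f t) (q t) * f' + partial_p h (f t) (q t) * q'"
proof -
  from diff obtain D where D: "((\<lambda>(x, y). h x y) has_derivative D) (at (f t, q t))"
    unfolding differentiable_def by blast
  have lin: "linear D" using D by (rule has_derivative_linear)
  have chain: "deriv (\<lambda>r. h (a r) (b r)) u = D (a', b')"
    if "(a has_real_derivative a') (at u)" "(b has_real_derivative b') (at u)" "a u = f t" "b u = q t"
    for a b a' b' u
  proof -
    have "((\<lambda>r. (a r, b r)) has_derivative (\<lambda>r. (a' * r, b' * r))) (at u)"
      using that by (intro has_derivative_Pair) (simp_all add: has_field_derivative_def)
    moreover have "((\<lambda>(x, y). h x y) has_derivative D) (at (a u, b u))"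
      using D that by simp
    ultimately have "((\<lambda>r. (\<lambda>(x, y). h x y) (a r, b r)) has_derivative (\<lambda>r. D (a' * r, b' * r))) (at u)"
      by (rule has_derivative_compose)
    moreover have "D (a' * r, b' * r) = D (a', b') * r" for r
      using linear_scale[OF lin, of r "(a', b')"] by (simp add: mult.commute)
    ultimately have "((\<lambda>r. h (a r) (b r)) has_real_derivative D (a', b')) (at u)"
      by (simp add: has_field_derivative_def)
    then show ?thesis by (rule DERIV_imp_deriv)
  qed
  have "partial_s h (f t) (q t) = D (1, 0)"
    unfolding partial_s_def by (rule chain) (auto intro!: derivative_eq_intros)
  moreover have "partial_p h (f t) (q t) = D (0, 1)"
    unfolding partial_p_def by (rule chain) (auto intro!: derivative_eq_intros)
  moreover have "deriv (\<lambda>t. h (f t) (q t)) t = D (f', q')"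
    by (rule chain[OF f q]) simp_all
  moreover have "D (f', q') = f' * D (1, 0) + q' * D (0, 1)"
    using linear_add[OF lin, of "f' *\<^sub>R (1, 0)" "q' *\<^sub>R (0, 1)"]
    by (simp only: linear_scale[OF lin]) simp
  ultimately show ?thesis by simp
qed

context lorentz_frame begin

lemma comp2_unit_bivector:
  "comp2 (lower2 g (unit_bivector \<mu> \<nu>)) a b
    = (lower g (e a) $ \<mu> * lower g (e b) $ \<nu> - lower g (e a) $ \<nu> * lower g (e b) $ \<mu>) / 2"
proof -
  have ob: "(\<Sum>\<alpha>\<in>UNIV. \<Sum>\<beta>\<in>UNIV. x \<alpha> * y \<beta> * of_bool (\<alpha> = i) * of_bool (\<beta> = j)) = x i * y j"
    for x y :: "6 \<Rightarrow> real" and i j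
    by (simp only: sum_of_bool_eq)
  have "comp2 (lower2 g (unit_bivector \<mu> \<nu>)) a b =
    (\<Sum>\<alpha>\<in>UNIV. \<Sum>\<beta>\<in>UNIV. (lower g (e a) $ \<alpha> * lower g (e b) $ \<beta> * of_bool (\<alpha> = \<mu>) * of_bool (\<beta> = \<nu>)
      - lower g (e a) $ \<alpha> * lower g (e b) $ \<beta> * of_bool (\<alpha> = \<nu>) * of_bool (\<beta> = \<mu>)) / 2)"
    unfolding comp2_lower2 unit_bivector_def vec_lambda_beta of_bool_conj
    by (intro sum.cong refl) (simp add: algebra_simps)
  then show ?thesis
    unfolding sum_divide_distrib[symmetric] sum_subtractf ob .
qed

lemma antisym2_unit_bivector: "antisym2 (comp2 (lower2 g (unit_bivector \<mu> \<nu>)))"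
  unfolding antisym2_def comp2_unit_bivector by (simp add: field_simps)

text \<open>The directions in which \<open>H_tensor\<close> differentiates belong to the given
  basis. Contracting their labels with frame vectors yields the directions adapted to the
  frame.\<close>

lemma frame_unit_bivector:
  "(\<Sum>\<mu>\<in>UNIV. \<Sum>\<nu>\<in>UNIV. e c $ \<mu> * (e d $ \<nu> * comp2 (lower2 g (unit_bivector \<mu> \<nu>)) a b)) = frame_bivector c d a b"
proof -
  have "(\<Sum>\<mu>\<in>UNIV. \<Sum>\<nu>\<in>UNIV. e c $ \<mu> * (e d $ \<nu> * comp2 (lower2 g (unit_bivector \<mu> \<nu>)) a b))
    = (\<Sum>\<mu>\<in>UNIV. \<Sum>\<nu>\<in>UNIV. ((e c $ \<mu> * lower g (e a) $ \<mu>) * (e d $ \<nu> * lower g (e b) $ \<nu>)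
        - (e c $ \<mu> * lower g (e b) $ \<mu>) * (e d $ \<nu> * lower g (e a) $ \<nu>)) / 2)"
    unfolding comp2_unit_bivector by (intro sum.cong refl) (simp add: algebra_simps)
  also have "\<dots> = frame_bivector c d a b"
    unfolding sum_divide_distrib[symmetric] sum_subtractf sum_product[symmetric] frame_dual
      frame_bivector_def by (simp add: minkowski_commute)
  finally show ?thesis .
qed

text \<open>Along the line B + t L both s and p^2 are polynomials in t, with linear coefficients
  given by the polar forms. Positivity of p makes the square root differentiable at t = 0.\<close>

lemma H_tensor_value:
  assumes X: "antisym2 (comp2 B)"
    and diff: "(\<lambda>(x, y). h x y) differentiable (at (inv_s g B, inv_p g e (e 0) B))"
    and pos: "inv_p g e (e 0) B > 0"
  defines "hs \<equiv> partial_s h (inv_s g B) (inv_p g e (e 0) B)"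
    and "hp \<equiv> partial_p h (inv_s g B) (inv_p g e (e 0) B)"
  shows "H_tensor h g e (e 0) B $ \<mu> $ \<nu> =
     hs * (\<Sum>a\<in>UNIV. \<Sum>b\<in>UNIV. eta a * eta b * comp2 B a b * comp2 (lower2 g (unit_bivector \<mu> \<nu>)) a b)
     + 2 * (hp / inv_p g e (e 0) B) * (\<Sum>a\<in>UNIV. p_comp (comp2 B) a
         * p_polar (comp2 B) (comp2 (lower2 g (unit_bivector \<mu> \<nu>))) a)"
proof -
  define L where "L = lower2 g (unit_bivector \<mu> \<nu>)"
  define Q where "Q t = (\<Sum>a\<in>UNIV. eta a * (p_comp (comp2 B) a + t * p_polar (comp2 B) (comp2 L) a + t\<^sup>2 * p_comp (comp2 L) a)
     * (p_comp (comp2 B) a + t * p_polar (comp2 B) (comp2 L) a + t\<^sup>2 * p_comp (comp2 L) a))" for t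
  have L: "antisym2 (comp2 L)" unfolding L_def by (rule antisym2_unit_bivector)
  have comp: "comp2 (B + t *\<^sub>R L) = (\<lambda>a b. comp2 B a b + t * comp2 L a b)" for t
    by (simp add: fun_eq_iff comp2_linear)
  have s: "inv_s g (B + t *\<^sub>R L) = 1 / 4 * (\<Sum>a\<in>UNIV. \<Sum>b\<in>UNIV. eta a * eta b *
      (comp2 B a b + t * comp2 L a b) * (comp2 B a b + t * comp2 L a b))" for t
    unfolding inv_s_components comp ..
  have ds: "((\<lambda>t. inv_s g (B + t *\<^sub>R L)) has_real_derivative
      1 / 2 * (\<Sum>a\<in>UNIV. \<Sum>b\<in>UNIV. eta a * eta b * comp2 B a b * comp2 L a b)) (at 0)"
    unfolding s
    by (auto intro!: derivative_eq_intros simp: sum_distrib_left algebra_simps)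
  have p: "inv_p g e (e 0) (B + t *\<^sub>R L) = sqrt (Q t)" for t
    unfolding inv_p_components comp p_comp_add_scaled[OF X L] Q_def ..
  have p0: "inv_p g e (e 0) B = sqrt (Q 0)" using p[of 0] by simp
  have Q0: "Q 0 > 0" using pos unfolding p0 by simp
  have "(Q has_real_derivative 2 * (\<Sum>a\<in>UNIV. eta a * p_comp (comp2 B) a * p_polar (comp2 B) (comp2 L) a)) (at 0)"
    unfolding Q_def[abs_def]
    by (auto intro!: derivative_eq_intros simp: sum_distrib_left algebra_simps)
  \<comment> \<open>The vector p has no time component, and the spatial signs are all 1.\<close>
  moreover have "eta a * p_comp Y a = p_comp Y a" for a Y
    using p_comp_0 by (cases "a = 0") (simp_all add: minkowski_def)
  ultimately have "(Q has_real_derivative 2 * (\<Sum>a\<in>UNIV. p_comp (comp2 B) a * p_polar (comp2 B) (comp2 L) a)) (at 0)"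
    by simp
  from DERIV_real_sqrt[THEN DERIV_chain2, OF Q0 this]
  have dp: "((\<lambda>t. inv_p g e (e 0) (B + t *\<^sub>R L)) has_real_derivative
     (\<Sum>a\<in>UNIV. p_comp (comp2 B) a * p_polar (comp2 B) (comp2 L) a) / inv_p g e (e 0) B) (at 0)"
    unfolding p p0 by (simp add: field_simps)
  have "deriv (\<lambda>t. h (inv_s g (B + t *\<^sub>R L)) (inv_p g e (e 0) (B + t *\<^sub>R L))) 0
    = hs * (1 / 2 * (\<Sum>a\<in>UNIV. \<Sum>b\<in>UNIV. eta a * eta b * comp2 B a b * comp2 L a b))
     + hp * ((\<Sum>a\<in>UNIV. p_comp (comp2 B) a * p_polar (comp2 B) (comp2 L) a) / inv_p g e (e 0) B)"
    using deriv_compose_partials[OF _ ds dp, of h] diff by (simp add: hs_def hp_def)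
  then show ?thesis
    unfolding H_tensor_def L_def by (simp add: Let_def)
qed

text \<open>Linearity of the polar form carries the contraction with two frame vectors into the
  direction of differentiation. What remains of the p-term is the definition of
  \<open>cubic\<close>.\<close>

lemma comp2_H_tensor:
  assumes X: "antisym2 (comp2 B)"
    and diff: "(\<lambda>(x, y). h x y) differentiable (at (inv_s g B, inv_p g e (e 0) B))"
    and pos: "inv_p g e (e 0) B > 0"
  shows "comp2 (H_tensor h g e (e 0) B) c d = partial_s h (inv_s g B) (inv_p g e (e 0) B) * comp2 B c d
    + partial_p h (inv_s g B) (inv_p g e (e 0) B) / inv_p g e (e 0) B * cubic (comp2 B) c d"
proof -
  let ?X = "comp2 B" and ?L = "\<lambda>\<mu> \<nu>. comp2 (lower2 g (unit_bivector \<mu> \<nu>))"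
  let ?hs = "partial_s h (inv_s g B) (inv_p g e (e 0) B)"
    and ?k = "partial_p h (inv_s g B) (inv_p g e (e 0) B) / inv_p g e (e 0) B"
  have fb: "frame_bivector c d = (\<lambda>a b. \<Sum>\<mu>\<in>UNIV. e c $ \<mu> * (\<Sum>\<nu>\<in>UNIV. e d $ \<nu> * ?L \<mu> \<nu> a b))"
    unfolding fun_eq_iff frame_unit_bivector[symmetric] sum_distrib_left by simp
  have polar: "p_polar ?X (frame_bivector c d) a
      = (\<Sum>\<mu>\<in>UNIV. \<Sum>\<nu>\<in>UNIV. e c $ \<mu> * e d $ \<nu> * p_polar ?X (?L \<mu> \<nu>) a)" for a
    unfolding fb
    by (subst p_polar_sum[OF X finite antisym2_sum[OF antisym2_unit_bivector]],
        subst p_polar_sum[OF X finite antisym2_unit_bivector])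
       (simp only: sum_distrib_left mult.assoc)
  have "comp2 (H_tensor h g e (e 0) B) c d
    = (\<Sum>\<mu>\<in>UNIV. \<Sum>\<nu>\<in>UNIV. \<Sum>a\<in>UNIV. \<Sum>b\<in>UNIV. ?hs * (eta a * eta b * ?X a b) * (e c $ \<mu> * (e d $ \<nu> * ?L \<mu> \<nu> a b)))
     + (\<Sum>\<mu>\<in>UNIV. \<Sum>\<nu>\<in>UNIV. \<Sum>a\<in>UNIV. (2 * ?k * p_comp ?X a) * (e c $ \<mu> * e d $ \<nu> * p_polar ?X (?L \<mu> \<nu>) a))"
    unfolding comp2_def[of "H_tensor h g e (e 0) B"] H_tensor_value[OF assms] distrib_left sum.distrib
      sum_distrib_left by (simp only: mult_ac)
  also have "(\<Sum>\<mu>\<in>UNIV. \<Sum>\<nu>\<in>UNIV. \<Sum>a\<in>UNIV. \<Sum>b\<in>UNIV. ?hs * (eta a * eta b * ?X a b) * (e c $ \<mu> * (e d $ \<nu> * ?L \<mu> \<nu> a b)))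
    = (\<Sum>a\<in>UNIV. \<Sum>b\<in>UNIV. ?hs * (eta a * eta b * ?X a b) * frame_bivector c d a b)"
    unfolding frame_unit_bivector[symmetric] sum_distrib_left by (rule sum_swap_2_2)
  also have "\<dots> = ?hs * ?X c d"
  proof -
    have "(\<Sum>a\<in>UNIV. \<Sum>b\<in>UNIV. ?hs * (eta a * eta b * ?X a b) * frame_bivector c d a b)
      = ?hs / 2 * ((\<Sum>a\<in>UNIV. \<Sum>b\<in>UNIV. eta a * eta b * ?X a b * minkowski c a * minkowski d b)
        - (\<Sum>a\<in>UNIV. \<Sum>b\<in>UNIV. eta a * eta b * ?X a b * minkowski d a * minkowski c b))"
      unfolding frame_bivector_def sum_subtractf[symmetric] sum_distrib_left
      by (intro sum.cong refl) (simp add: minkowski_commute[of c] minkowski_commute[of d] field_simps)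
    also have "\<dots> = ?hs / 2 * ((eta c * eta c) * (eta d * eta d) * ?X c d - (eta c * eta c) * (eta d * eta d) * ?X d c)"
      by (simp only: sum_minkowski sum_distrib_right[symmetric]) (simp only: mult_ac)
    also have "\<dots> = ?hs * ?X c d"
    proof -
      \<comment> \<open>The two halves of the frame bivector give X c d and - X d c. Antisymmetry
        makes them equal, which absorbs the normalization by 1/2.\<close>
      have "?X d c = - ?X c d" using X unfolding antisym2_def by blast
      then show ?thesis by (simp add: minkowski_sq)
    qed
    finally show ?thesis .
  qed
  also have "(\<Sum>\<mu>\<in>UNIV. \<Sum>\<nu>\<in>UNIV. \<Sum>a\<in>UNIV. (2 * ?k * p_comp ?X a) * (e c $ \<mu> * e d $ \<nu> * p_polar ?X (?L \<mu> \<nu>) a))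
    = (\<Sum>a\<in>UNIV. (2 * ?k * p_comp ?X a) * p_polar ?X (frame_bivector c d) a)"
    unfolding polar sum_distrib_left by (rule sum_swap_2_1)
  also have "\<dots> = ?k * cubic ?X c d"
    unfolding cubic_def sum_distrib_left by (simp only: mult_ac)
  finally show ?thesis .
qed

end

context lorentz_frame begin

lemma antisym3_comp3:
  assumes "three_form F"
  shows "antisym3 (comp3 F)"
proof -
  have F1: "F $ i $ j $ k = - F $ j $ i $ k" and F2: "F $ i $ j $ k = - F $ i $ k $ j" for i j k
    using assms unfolding three_form_def by blast+
  have "comp3 F a b c = - comp3 F b a c" for a b c
  proof -
    have "comp3 F a b c = (\<Sum>\<nu>\<in>UNIV. \<Sum>\<mu>\<in>UNIV. \<Sum>\<rho>\<in>UNIV. e a $ \<mu> * e b $ \<nu> * e c $ \<rho> * F $ \<mu> $ \<nu> $ \<rho>)"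
      unfolding comp3_def by (rule sum.swap)
    also have "\<dots> = - comp3 F b a c"
      unfolding comp3_def sum_negf[symmetric]
    proof (intro sum.cong refl)
      fix i j k
      show "e a $ j * e b $ i * e c $ k * F $ j $ i $ k = - (e b $ i * e a $ j * e c $ k * F $ i $ j $ k)"
        using F1[of j i k] by simp
    qed
    finally show ?thesis .
  qed
  moreover have "comp3 F a b c = - comp3 F a c b" for a b c
  proof -
    have "comp3 F a b c = (\<Sum>\<mu>\<in>UNIV. \<Sum>\<rho>\<in>UNIV. \<Sum>\<nu>\<in>UNIV. e a $ \<mu> * e b $ \<nu> * e c $ \<rho> * F $ \<mu> $ \<nu> $ \<rho>)"
      unfolding comp3_def by (intro sum.cong refl sum.swap)
    also have "\<dots> = - comp3 F a c b"
      unfolding comp3_def sum_negf[symmetric]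
    proof (intro sum.cong refl)
      fix i j k
      show "e a $ i * e b $ k * e c $ j * F $ i $ k $ j = - (e a $ i * e c $ j * e b $ k * F $ i $ j $ k)"
        using F2[of i k j] by simp
    qed
    finally show ?thesis .
  qed
  ultimately show ?thesis unfolding antisym3_def by blast
qed

end

section \<open>The identity, checked in an adapted frame\<close>

theorem mainTheorem9:
  fixes g :: "real^6^6" and e :: "6 \<Rightarrow> real^6" and v :: "real^6"
    and F :: "real^6^6^6" and E B :: "real^6^6"
    and \<H> :: "real \<Rightarrow> real \<Rightarrow> real" and D :: "(real \<times> real) set" and s p :: real
  assumes g_sym: "transpose g = g"
    and frame: "orthonormal_frame g e"
    and v_unit: "(\<Sum>\<mu>\<in>UNIV. v $ \<mu> * lower g v $ \<mu>) = -1"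
    and F_form: "three_form F"
    and E_eq: "E = contract_last F v"
    and B_eq: "B = contract_last (dual3 g e F) v"
    and D_open: "open D"
    and H_smooth: "smooth_on D (\<lambda>(x, y). \<H> x y)"
    and H_pde: "\<And>x y. (x, y) \<in> D \<Longrightarrow> y > 0 \<Longrightarrow>
        (partial_s \<H> x y)\<^sup>2 + 2 * x / y * partial_s \<H> x y * partial_p \<H> x y
          + (partial_p \<H> x y)\<^sup>2 = 1"
    and s_eq: "s = inv_s g B"
    and p_eq: "p = inv_p g e v B"
    and sp_in_D: "(s, p) \<in> D"
    and p_nz: "p \<noteq> 0"
    and self_dual: "E = H_tensor \<H> g e v B"
  shows "pst_tensor \<H> g e v B =
      (s * partial_s \<H> s p + p * partial_p \<H> s p - \<H> s p) *\<^sub>R g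
        + (1 / 4) *\<^sub>R symmetrize (FF_dual g e F)"
proof -
  have "ip g v v = -1" using v_unit by (simp add: ip_lower)
  then obtain f where f: "orthonormal_frame g f" "f 0 = v" "levi_civita f = levi_civita e"
    using exists_adapted_frame[OF g_sym frame] by blast
  interpret lorentz_frame g f
    by unfold_locales (rule g_sym, rule f(1))
  \<comment> \<open>The original frame enters every tensor through \<open>levi_civita\<close> alone,
    so each of them may be computed with \<open>f\<close>.\<close>
  have dual3_up: "dual3_up e = dual3_up f"
    by (rule ext) (simp add: dual3_up_def f(3))
  have p_up: "p_up g e v = p_up g f (f 0)"
    by (rule ext) (simp add: p_up_def f)
  have p_down: "p_down g e v = p_down g f (f 0)"
    by (rule ext) (simp add: p_down_def p_up)
  have inv_p: "inv_p g e v = inv_p g f (f 0)"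
    by (rule ext) (simp add: inv_p_def p_up p_down)
  have H_tensor: "H_tensor \<H> g e v B = H_tensor \<H> g f (f 0) B"
    by (simp add: H_tensor_def inv_p)
  have FF_dual: "FF_dual g e F = FF_dual g f F"
    by (simp add: FF_dual_def dual3_up)
  have dual3: "dual3 g e F = dual3 g f F"
    by (simp add: dual3_def dual3_up)
  define hs hp where "hs = partial_s \<H> s p" and "hp = partial_p \<H> s p"

  have antisym_F: "antisym3 (comp3 F)"
    using F_form by (rule antisym3_comp3)
  have X: "comp2 B a b = - (eta a * eta b) * dual_comp (comp3 F) a b 0" for a b
    unfolding B_eq dual3 f(2)[symmetric] comp2_contract_last comp3_dual3 by (simp add: minkowski_def)
  have antisym_X: "antisym2 (comp2 B)"
  proof -
    have "dual_comp (comp3 F) a b 0 = - dual_comp (comp3 F) b a 0" for a b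
      using antisym3_dual_comp[of "comp3 F"] unfolding antisym3_def by blast
    then show ?thesis
      unfolding antisym2_def X by (metis mult.commute mult_minus_right)
  qed
  have p: "p = inv_p g f (f 0) B" by (simp add: p_eq inv_p)
  \<comment> \<open>Since p is spatial, its norm is a sum of squares. Hence the square root in
    \<open>inv_p\<close> is genuine, and p nonzero means p > 0, as the differential equation and the
    derivative of the root require.\<close>
  have sum_p_nonneg: "0 \<le> (\<Sum>a\<in>UNIV. eta a * p_comp (comp2 B) a * p_comp (comp2 B) a)"
    by (rule sum_nonneg) (simp add: minkowski_def p_comp_0 mult.assoc)
  then have p_sq: "p\<^sup>2 = (\<Sum>a\<in>UNIV. eta a * p_comp (comp2 B) a * p_comp (comp2 B) a)"
    by (simp add: p inv_p_components)
  have "p \<ge> 0" using sum_p_nonneg by (simp add: p inv_p_components)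
  with p_nz have p_pos: "p > 0" by simp
  have "Ck_on (Suc 0) D (\<lambda>(x, y). \<H> x y)"
    using H_smooth unfolding smooth_on_def by blast
  then have "(\<lambda>(x, y). \<H> x y) differentiable_on D"
    by (simp only: Ck_on.simps)
  then have "(\<lambda>(x, y). \<H> x y) differentiable (at (s, p) within D)"
    using sp_in_D unfolding differentiable_on_def by blast
  then have diff: "(\<lambda>(x, y). \<H> x y) differentiable (at (s, p))"
    by (simp only: at_within_open[OF sp_in_D D_open])
  have E: "comp3 F a b 0 = hs * comp2 B a b + hp / p * cubic (comp2 B) a b" for a b
  proof -
    have "comp3 F a b 0 = comp2 (H_tensor \<H> g f (f 0) B) a b"
      unfolding comp2_contract_last[symmetric] f(2) E_eq[symmetric] self_dual H_tensor[unfolded f(2)] ..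
    also have "\<dots> = hs * comp2 B a b + hp / p * cubic (comp2 B) a b"
      using comp2_H_tensor[OF antisym_X, of \<H> a b] diff p_pos
      unfolding hs_def hp_def s_eq p by simp
    finally show ?thesis .
  qed
  interpret sd: self_dual_components "comp3 F" "comp2 B" hs hp "hp / p" s p
  proof unfold_locales
    show "hs\<^sup>2 + 2 * s * hs * (hp / p) + hp\<^sup>2 = 1"
      using H_pde[OF sp_in_D p_pos] by (simp add: hs_def hp_def)
    show "s = 1 / 4 * (\<Sum>a\<in>UNIV. \<Sum>b\<in>UNIV. eta a * eta b * comp2 B a b * comp2 B a b)"
      unfolding s_eq inv_s_components ..
  qed (use antisym_F X E p_sq p_nz in simp_all)
  let ?HB = "contract2 g E B"
  have HB: "?HB = (\<Sum>a\<in>UNIV. \<Sum>b\<in>UNIV. eta a * eta b * sd.E a b * comp2 B a b)"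
    unfolding contract2_components E_eq f(2)[symmetric] comp2_contract_last sd.E_def ..
  have E': "comp2 E a b = sd.E a b" for a b
    unfolding E_eq f(2)[symmetric] comp2_contract_last sd.E_def ..
  have outer: "comp2 (\<chi> \<mu> \<nu>. u $ \<mu> * w $ \<nu>) a b = (\<Sum>\<mu>\<in>UNIV. f a $ \<mu> * u $ \<mu>) * (\<Sum>\<nu>\<in>UNIV. f b $ \<nu> * w $ \<nu>)" for u w a b
    unfolding comp2_def sum_product by (simp add: mult_ac)
  have swap: "comp2 (\<chi> \<mu> \<nu>. Y $ \<nu> $ \<mu>) a b = comp2 Y b a" for Y a b
    unfolding comp2_def vec_lambda_beta by (subst sum.swap) (simp only: mult_ac)
  have sym: "symmetrize Y = (1 / 2) *\<^sub>R Y + (1 / 2) *\<^sub>R (\<chi> \<mu> \<nu>. Y $ \<nu> $ \<mu>)" for Y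
    by (simp add: symmetrize_def vec_eq_iff add_divide_distrib)
  have comp_g: "comp2 g a b = minkowski a b" for a b
    using f(1) unfolding orthonormal_frame_def comp2_def by (simp only: mult_ac)
  let ?v = "lower g v" and ?p = "p_down g f (f 0) B"
  let ?M = "\<chi> \<mu> \<nu>. \<Sum>\<sigma>\<in>UNIV. \<Sum>\<rho>\<in>UNIV. E $ \<mu> $ \<sigma> * matrix_inv g $ \<sigma> $ \<rho> * B $ \<nu> $ \<rho>"
  \<comment> \<open>Written as a linear combination of tensors, so that frame components can be
    taken term by term.\<close>
  have pst: "pst_tensor \<H> g e v B = (- (\<H> s p - 1 / 2 * ?HB)) *\<^sub>R g
      + (1 / 2 * ?HB) *\<^sub>R (\<chi> \<mu> \<nu>. ?v $ \<mu> * ?v $ \<nu>) - ?M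
      - 2 *\<^sub>R symmetrize (\<chi> \<mu> \<nu>. ?v $ \<mu> * ?p $ \<nu>)"
    unfolding pst_tensor_def Let_def self_dual[symmetric] s_eq[symmetric] p_eq[symmetric] p_down
    by (simp add: vec_eq_iff) (simp add: algebra_simps)
  have v: "(\<Sum>\<mu>\<in>UNIV. f a $ \<mu> * ?v $ \<mu>) = minkowski 0 a" for a
    unfolding f(2)[symmetric] frame_dual by (rule minkowski_commute)
  show ?thesis
  proof (rule comp2_eqI)
    fix a b
    have "comp2 (pst_tensor \<H> g e v B) a b = - minkowski a b * (\<H> s p - 1 / 2 * ?HB)
       + 1 / 2 * minkowski 0 a * minkowski 0 b * ?HB
       - (\<Sum>c\<in>UNIV. eta c * sd.E a c * comp2 B b c)
       - (minkowski 0 a * (eta b * p_comp (comp2 B) b) + minkowski 0 b * (eta a * p_comp (comp2 B) a))"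
      unfolding pst sym comp2_linear swap outer v p_down_component comp2_contraction comp_g E'
      by (simp add: algebra_simps)
    also have "\<dots> = (s * hs + p * hp - \<H> s p) * minkowski a b + (sd.FF a b + sd.FF b a) / 8"
      unfolding HB by (rule sd.pst_components)
    also have "\<dots> = comp2 ((s * hs + p * hp - \<H> s p) *\<^sub>R g + (1 / 4) *\<^sub>R symmetrize (FF_dual g e F)) a b"
      unfolding sym comp2_linear swap comp_g FF_dual comp2_FF_dual sd.FF_def by simp
    finally show "comp2 (pst_tensor \<H> g e v B) a b = comp2 ((s * partial_s \<H> s p + p * partial_p \<H> s p - \<H> s p) *\<^sub>R g
        + (1 / 4) *\<^sub>R symmetrize (FF_dual g e F)) a b"
      unfolding hs_def hp_def .
  qed
qed

end
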